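(* Let $(E,A)$ be a system and $(E^*,A^* )$ its dual system. Then for all $k\ge1$ $$\alpha_k(E^*,A^* )=\alpha_k(E,A),\qquad \beta_k^+(E^*,A^* )=\beta_k^-(E,A),\qquad \beta_k^-(E^*,A^* )=\beta_k^+(E,A).$$
   Context: Fix a field $\mathbb K$. A system $(E,A)$ is a pair of $\mathbb K$-linear maps $E,A:M\to V$ with the same finite-dimensional domain $M$ and the same finite-dimensional codomain $V$. Reduction: put $V'=EM$ and $M'=A^{-1}V'=\{x\in M: Ax\in V'\}$. Then $E$ and $A$ map $M'$ into $V'$; let $E',A':M'\to V'$ be the restrictions. The reduced system is $(E,A)'=(E',A')$. Define $(E^{(0)},A^{(0)})=(E,A)$ and $(E^{(k+1)},A^{(k+1)})=(E^{(k)},A^{(k)})'$, with domain $M^{(k)}$ and codomain $V^{(k)}$ of $(E^{(k)},A^{(k)})$; so $V''=V^{(2)}=EM'$. The index $n$ of $(E,A)$ is the smallest integer $n\ge 0$ with $(E^{(n+1)},A^{(n+1)})=(E^{(n)},A^{(n)})$ (it always exists), and $(E^{(\infty)},A^{(\infty)}):=(E^{(n)},A^{(n)})$. Defects: let $[A]:M/M'\to V/V'$ and $[E]:M/M'\to V'/V''$ be the maps induced by $A$ and $E$ on the quotients. Put $\beta_1^+(E,A)=\dim\operatorname{coker}[A]$, $\alpha_1(E,A)=\dim\ker[E]$, and for $k\ge1$, $\alpha_k(E,A)=\alpha_1(E^{(k-1)},A^{(k-1)})$, $\beta^+_k(E,A)=\beta^+_1(E^{(k-1)},A^{(k-1)})$.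 The dual system of $(E,A)$ is the pair of adjoint (transpose) maps $(E^*,A^* )$, $E^*,A^*:V^*\to M^*$. Write $(E^{(\infty)*},A^{(\infty)*})$ for the dual of $(E^{(\infty)},A^{(\infty)})$. For $k\ge1$, $\beta^-_k(E,A):=\beta^+_k(E^{(\infty)*},A^{(\infty)*})$. *)

theory Defs
  imports "Jordan_Normal_Form.Missing_VectorSpace" "HOL-Algebra.AbelCoset"
begin

section \<open>Quotients, cokernels and duals of vector spaces\<close>

text \<open>
  The elements of the quotient \<open>V / W\<close> are the cosets of \<open>W\<close>. In \<open>smult\<close> the summand \<open>W\<close> matters
  for the scalar \<open>0\<close>, where the image of a coset is only \<open>{0}\<close>. The multiplicative fields of the
  record play no role for modules; they are filled as in \<^const>\<open>ring.func_space\<close>.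
\<close>

definition quot_space :: "('k, 'v) module \<Rightarrow> 'v set \<Rightarrow> ('k, 'v set) module" where
  "quot_space V W =
     \<lparr>carrier = a_rcosets\<^bsub>V\<^esub> W,
      mult = (\<lambda>X Y. W),
      one = W,
      zero = W,
      add = (\<lambda>X Y. X <+>\<^bsub>V\<^esub> Y),
      smult = (\<lambda>c X. ((\<lambda>x. c \<odot>\<^bsub>V\<^esub> x) ` X) <+>\<^bsub>V\<^esub> W)\<rparr>"

text \<open>
  The map \<open>x + U \<mapsto> f x + W\<close> induced by \<open>f\<close> on \<open>M / U\<close> with values in \<open>N / W\<close>, where \<open>f\<close> maps
  \<open>U\<close> into \<open>W\<close>: then \<open>f ` (x + U) + W = f x + W\<close>.
\<close>

definition quot_map :: "('k, 'w) module \<Rightarrow> 'w set \<Rightarrow> ('v \<Rightarrow> 'w) \<Rightarrow> 'v set \<Rightarrow> 'w set" where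
  "quot_map N W f X = (f ` X) <+>\<^bsub>N\<^esub> W"

definition ker_space :: "('k, 'v) module \<Rightarrow> ('k, 'w) module \<Rightarrow> ('v \<Rightarrow> 'w) \<Rightarrow> ('k, 'v) module" where
  "ker_space M N f = M\<lparr>carrier := mod_hom.ker M N f\<rparr>"

definition coker_space :: "('k, 'v) module \<Rightarrow> ('k, 'w) module \<Rightarrow> ('v \<Rightarrow> 'w) \<Rightarrow> ('k, 'w set) module"
  where "coker_space M N f = quot_space N (mod_hom.im M f)"

definition self_module :: "('k, 'r) ring_scheme \<Rightarrow> ('k, 'k) module" where
  "self_module K =
     \<lparr>carrier = carrier K, mult = mult K, one = one K, zero = zero K, add = add K,
      smult = mult K\<rparr>"

text \<open>
  A linear form on \<open>V\<close> is represented by the function that is \<^const>\<open>undefined\<close> outside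
  \<open>carrier V\<close>, so that distinct elements of the dual differ on \<open>carrier V\<close>.
\<close>

definition dual_space :: "('k, 'r) ring_scheme \<Rightarrow> ('k, 'v) module \<Rightarrow> ('k, 'v \<Rightarrow> 'k) module" where
  "dual_space K V =
     (ring.func_space K (carrier V))
       \<lparr>carrier := module_hom K V (self_module K) \<inter> extensional (carrier V)\<rparr>"

definition adjoint :: "('k, 'v) module \<Rightarrow> ('v \<Rightarrow> 'w) \<Rightarrow> ('w \<Rightarrow> 'k) \<Rightarrow> ('v \<Rightarrow> 'k)" where
  "adjoint M f \<phi> = (\<lambda>x\<in>carrier M. \<phi> (f x))"

section \<open>Systems\<close>

record ('k, 'm, 'v) lin_system =
  sys_dom :: "('k, 'm) module"
  sys_cod :: "('k, 'v) module"
  sys_E :: "'m \<Rightarrow> 'v"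
  sys_A :: "'m \<Rightarrow> 'v"

definition is_system :: "('k, 'r) ring_scheme \<Rightarrow> ('k, 'm, 'v) lin_system \<Rightarrow> bool" where
  "is_system K S \<longleftrightarrow>
     field K \<and>
     linear_map K (sys_dom S) (sys_cod S) (sys_E S) \<and>
     linear_map K (sys_dom S) (sys_cod S) (sys_A S) \<and>
     vectorspace.fin_dim K (sys_dom S) \<and>
     vectorspace.fin_dim K (sys_cod S)"

definition red_cod :: "('k, 'm, 'v) lin_system \<Rightarrow> 'v set" where
  "red_cod S = sys_E S ` carrier (sys_dom S)"

definition red_dom :: "('k, 'm, 'v) lin_system \<Rightarrow> 'm set" where
  "red_dom S = {x \<in> carrier (sys_dom S). sys_A S x \<in> red_cod S}"

text \<open>
  The restrictions of \<open>E\<close> and \<open>A\<close> are the same functions on a smaller carrier. Two iterated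
  reductions of a system thus share these functions and are equal as records iff they have the same
  domain and codomain.
\<close>

definition reduce :: "('k, 'm, 'v) lin_system \<Rightarrow> ('k, 'm, 'v) lin_system" where
  "reduce S = S\<lparr>sys_dom := (sys_dom S)\<lparr>carrier := red_dom S\<rparr>,
                sys_cod := (sys_cod S)\<lparr>carrier := red_cod S\<rparr>\<rparr>"

definition sys_index :: "('k, 'm, 'v) lin_system \<Rightarrow> nat" where
  "sys_index S = (LEAST n. (reduce ^^ Suc n) S = (reduce ^^ n) S)"

definition reduce_inf :: "('k, 'm, 'v) lin_system \<Rightarrow> ('k, 'm, 'v) lin_system" where
  "reduce_inf S = (reduce ^^ sys_index S) S"

definition dual_system ::
    "('k, 'r) ring_scheme \<Rightarrow> ('k, 'm, 'v) lin_system \<Rightarrow> ('k, 'v \<Rightarrow> 'k, 'm \<Rightarrow> 'k) lin_system" where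
  "dual_system K S =
     \<lparr>sys_dom = dual_space K (sys_cod S),
      sys_cod = dual_space K (sys_dom S),
      sys_E = adjoint (sys_dom S) (sys_E S),
      sys_A = adjoint (sys_dom S) (sys_A S)\<rparr>"

section \<open>Defects\<close>

text \<open>\<open>M / M'\<close>, \<open>V / V'\<close> and \<open>V' / V''\<close>\<close>

definition dom_quot :: "('k, 'm, 'v) lin_system \<Rightarrow> ('k, 'm set) module" where
  "dom_quot S = quot_space (sys_dom S) (red_dom S)"

definition cod_quot :: "('k, 'm, 'v) lin_system \<Rightarrow> ('k, 'v set) module" where
  "cod_quot S = quot_space (sys_cod S) (red_cod S)"

definition red_cod_quot :: "('k, 'm, 'v) lin_system \<Rightarrow> ('k, 'v set) module" where
  "red_cod_quot S = quot_space (sys_cod (reduce S)) (red_cod (reduce S))"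

definition A_quot :: "('k, 'm, 'v) lin_system \<Rightarrow> 'm set \<Rightarrow> 'v set" where
  "A_quot S = quot_map (sys_cod S) (red_cod S) (sys_A S)"

definition E_quot :: "('k, 'm, 'v) lin_system \<Rightarrow> 'm set \<Rightarrow> 'v set" where
  "E_quot S = quot_map (sys_cod (reduce S)) (red_cod (reduce S)) (sys_E S)"

definition beta1_plus :: "('k, 'r) ring_scheme \<Rightarrow> ('k, 'm, 'v) lin_system \<Rightarrow> nat" where
  "beta1_plus K S = vectorspace.dim K (coker_space (dom_quot S) (cod_quot S) (A_quot S))"

definition alpha1 :: "('k, 'r) ring_scheme \<Rightarrow> ('k, 'm, 'v) lin_system \<Rightarrow> nat" where
  "alpha1 K S = vectorspace.dim K (ker_space (dom_quot S) (red_cod_quot S) (E_quot S))"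

text \<open>The following are meaningful for \<open>k \<ge> 1\<close> only.\<close>

definition alpha :: "('k, 'r) ring_scheme \<Rightarrow> ('k, 'm, 'v) lin_system \<Rightarrow> nat \<Rightarrow> nat" where
  "alpha K S k = alpha1 K ((reduce ^^ (k - 1)) S)"

definition beta_plus :: "('k, 'r) ring_scheme \<Rightarrow> ('k, 'm, 'v) lin_system \<Rightarrow> nat \<Rightarrow> nat" where
  "beta_plus K S k = beta1_plus K ((reduce ^^ (k - 1)) S)"

definition beta_minus :: "('k, 'r) ring_scheme \<Rightarrow> ('k, 'm, 'v) lin_system \<Rightarrow> nat \<Rightarrow> nat" where
  "beta_minus K S k = beta_plus K (dual_system K (reduce_inf S)) k"

end

(*
  Let V_k and M_k be the codomain and domain of the k-th reduction, so M_k is the preimage of V_k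
  under A and V_(k+1) = E M_k. Let P_0 = 0 and let P_(k+1) be the preimage of A P_k under E. Since
  the adjoint of a map sends the annihilator of W onto the annihilator of the preimage of W, the
  k-th reduction of the dual system has codomain the annihilator of P_k and domain the annihilator
  of A P_k; dually, the k-th term of the chain of the dual system is the annihilator of V_k.

  All defects thus become differences of dimensions. With e_k = dim (ker E Int M_k) and
  a_k = dim (ker A Int P_k) one gets alpha_k = e_(k-1) - e_k for the system and
  beta_k^+ = a_k - a_(k-1) for its dual. Both A (P_i Int M_(j+1)) and E (P_(i+1) Int M_j) equal
  A P_i Int V_(j+1), so dim (P_(i+1) Int M_j) - dim (P_i Int M_(j+1)) = e_j - a_i. Summing along
  i + j = k gives dim P_(k+1) - dim P_k = e_k - a_k, from which alpha_k is self-dual. Finally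
  a_k does not change when the system is replaced by its final reduction, because every chain that
  ends in ker A lies in all M_k.
*)
theory Submission
  imports Defs
begin

section \<open>Subspaces and linear maps\<close>

text \<open>Changing only the carrier of the ambient record lets subspaces of every iterated
  reduction be measured inside the original spaces.\<close>

abbreviation subdim :: "('k, 'r) ring_scheme \<Rightarrow> ('k, 'v, 'z) module_scheme \<Rightarrow> 'v set \<Rightarrow> nat" where
  "subdim K V W \<equiv> vectorspace.dim K (V\<lparr>carrier := W\<rparr>)"

locale fin_dim_space = vectorspace K V for K and V +
  assumes fin_dim: "fin_dim"

lemma subspaceI:
  assumes "vectorspace K V" "W \<subseteq> carrier V" "\<zero>\<^bsub>V\<^esub> \<in> W"
    and "\<And>x y. x \<in> W \<Longrightarrow> y \<in> W \<Longrightarrow> x \<oplus>\<^bsub>V\<^esub> y \<in> W"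
    and "\<And>c x. c \<in> carrier K \<Longrightarrow> x \<in> W \<Longrightarrow> c \<odot>\<^bsub>V\<^esub> x \<in> W"
  shows "subspace K W V"
  using assms unfolding subspace_def submodule_def vectorspace_def by blast

lemma subspaceD:
  assumes "subspace K W V"
  shows "vectorspace K V" "W \<subseteq> carrier V" "\<zero>\<^bsub>V\<^esub> \<in> W"
    and "x \<in> W \<Longrightarrow> y \<in> W \<Longrightarrow> x \<oplus>\<^bsub>V\<^esub> y \<in> W"
    and "c \<in> carrier K \<Longrightarrow> x \<in> W \<Longrightarrow> c \<odot>\<^bsub>V\<^esub> x \<in> W"
  using assms unfolding subspace_def submodule_def by blast+

lemma subspace_neg:
  assumes "subspace K W V" "x \<in> W"
  shows "\<ominus>\<^bsub>V\<^esub> x \<in> W"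
proof -
  interpret vectorspace K V using assms(1) by (rule subspaceD)
  show ?thesis using subspaceD[OF assms(1)] assms(2) smult_minus_1 by (metis R.add.inv_closed R.one_closed subsetD)
qed

lemma subspace_carrier: "vectorspace K V \<Longrightarrow> subspace K (carrier V) V"
proof -
  assume "vectorspace K V"
  then interpret vectorspace K V .
  show ?thesis by (rule subspaceI) (auto intro: vectorspace_axioms)
qed

lemma subspace_Int:
  assumes "subspace K U V" "subspace K W V"
  shows "subspace K (U \<inter> W) V"
  using subspaceD[OF assms(1)] subspaceD[OF assms(2)] by (intro subspaceI) auto

lemma subspace_trans:
  assumes "subspace K W V" "subspace K U (V\<lparr>carrier := W\<rparr>)"
  shows "subspace K U V"
  using subspaceD[OF assms(1)] subspaceD[OF assms(2)] by (intro subspaceI) auto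

lemma subspace_restrict:
  assumes "subspace K W V" "subspace K U V" "U \<subseteq> W"
  shows "subspace K U (V\<lparr>carrier := W\<rparr>)"
  using subspaceD[OF assms(1)] subspaceD[OF assms(2)] assms(3)
    vectorspace.subspace_is_vs[OF _ assms(1)] by (intro subspaceI) auto

lemma linear_mapI:
  assumes "vectorspace K V" "vectorspace K W" "f \<in> carrier V \<rightarrow> carrier W"
    and "\<And>x y. x \<in> carrier V \<Longrightarrow> y \<in> carrier V \<Longrightarrow> f (x \<oplus>\<^bsub>V\<^esub> y) = f x \<oplus>\<^bsub>W\<^esub> f y"
    and "\<And>c x. c \<in> carrier K \<Longrightarrow> x \<in> carrier V \<Longrightarrow> f (c \<odot>\<^bsub>V\<^esub> x) = c \<odot>\<^bsub>W\<^esub> f x"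
  shows "linear_map K V W f"
  using assms
  unfolding linear_map_def mod_hom_def mod_hom_axioms_def module_hom_def vectorspace_def by blast

lemma linear_mapD:
  assumes "linear_map K V W f"
  shows "vectorspace K V" "vectorspace K W"
    and "x \<in> carrier V \<Longrightarrow> f x \<in> carrier W"
    and "x \<in> carrier V \<Longrightarrow> y \<in> carrier V \<Longrightarrow> f (x \<oplus>\<^bsub>V\<^esub> y) = f x \<oplus>\<^bsub>W\<^esub> f y"
    and "c \<in> carrier K \<Longrightarrow> x \<in> carrier V \<Longrightarrow> f (c \<odot>\<^bsub>V\<^esub> x) = c \<odot>\<^bsub>W\<^esub> f x"
    and "f \<zero>\<^bsub>V\<^esub> = \<zero>\<^bsub>W\<^esub>"
  using assms mod_hom.f0_is_0[of K V W f]
  unfolding linear_map_def mod_hom_def mod_hom_axioms_def module_hom_def vectorspace_def by blast+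

lemma linear_map_restrict:
  assumes f: "linear_map K V W f" and U: "subspace K U V" and X: "subspace K X W" and "f ` U \<subseteq> X"
  shows "linear_map K (V\<lparr>carrier := U\<rparr>) (W\<lparr>carrier := X\<rparr>) f"
  using vectorspace.subspace_is_vs[OF linear_mapD(1)[OF f] U]
    vectorspace.subspace_is_vs[OF linear_mapD(2)[OF f] X] assms(4)
    subsetD[OF subspaceD(2)[OF U]] linear_mapD(4,5)[OF f]
  by (intro linear_mapI) auto

lemma linear_map_restrict_dom:
  assumes "linear_map K V W f" "subspace K U V"
  shows "linear_map K (V\<lparr>carrier := U\<rparr>) W f"
  using linear_map_restrict[OF assms subspace_carrier[OF linear_mapD(2)[OF assms(1)]]]
    linear_mapD(3)[OF assms(1)] subspaceD(2)[OF assms(2)]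
  by auto

lemma linear_map_comp:
  assumes "linear_map K V W f" "linear_map K W X g"
  shows "linear_map K V X (\<lambda>x. g (f x))"
  using linear_mapD[OF assms(1)] linear_mapD[OF assms(2)] by (intro linear_mapI) auto

lemma subspace_image:
  assumes f: "linear_map K V W f" and U: "subspace K U V"
  shows "subspace K (f ` U) W"
proof -
  interpret g: linear_map K "V\<lparr>carrier := U\<rparr>" W f by (rule linear_map_restrict_dom[OF assms])
  show ?thesis using g.imT_is_subspace unfolding g.im_def by simp
qed

lemma subspace_preimage:
  assumes f: "linear_map K V W f" and X: "subspace K X W"
  shows "subspace K {x \<in> carrier V. f x \<in> X} V"
proof -
  interpret linear_map K V W f by (rule f)
  show ?thesis using subspaceD[OF X] linear_mapD(1)[OF f] by (intro subspaceI) auto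
qed

lemma subspace_kernel:
  assumes f: "linear_map K V W f" and U: "subspace K U V"
  shows "subspace K {x \<in> U. f x = \<zero>\<^bsub>W\<^esub>} V"
proof -
  interpret g: linear_map K "V\<lparr>carrier := U\<rparr>" W f by (rule linear_map_restrict_dom[OF assms])
  show ?thesis using subspace_trans[OF U g.kerT_is_subspace] unfolding g.ker_def by simp
qed

lemma subspace_zero: "vectorspace K V \<Longrightarrow> subspace K {\<zero>\<^bsub>V\<^esub>} V"
proof -
  assume "vectorspace K V"
  then interpret vectorspace K V .
  show ?thesis by (rule subspaceI) (auto intro: vectorspace_axioms)
qed

section \<open>Bases and dimensions of subspaces\<close>

lemma (in vectorspace) li_extend_to_basis:
  assumes fd: fin_dim and A: "lin_indpt A" "A \<subseteq> carrier V"
  obtains B where "A \<subseteq> B" "finite B" "basis B"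
proof -
  let ?P = "\<lambda>S. A \<subseteq> S \<and> S \<subseteq> carrier V \<and> lin_indpt S"
  have "\<exists>B. finite B \<and> maximal B ?P"
    by (rule maximal_exists[where N = dim and B = A]) (use li_le_dim[OF fd] A in auto)
  then obtain B where B: "finite B" "maximal B ?P" by blast
  \<comment> \<open>A set that contains \<open>B\<close> also contains \<open>A\<close>, so
    maximality among the independent supersets of \<open>A\<close> is maximality among all
    independent sets.\<close>
  have "maximal B (\<lambda>S. S \<subseteq> carrier V \<and> lin_indpt S)"
    unfolding maximal_def
  proof (intro conjI allI impI)
    show "B \<subseteq> carrier V" "lin_indpt B" using B(2) by (simp_all add: maximal_def)
    show "C = B" if "B \<subseteq> C \<and> C \<subseteq> carrier V \<and> lin_indpt C" for C
      using B(2) that subset_trans[of A B C] unfolding maximal_def by blast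
  qed
  from max_li_is_basis[OF this] have "basis B" .
  moreover have "A \<subseteq> B" using B(2) by (simp add: maximal_def)
  ultimately show thesis using that B(1) by blast
qed

lemma (in fin_dim_space) subspace_basis:
  assumes W: "subspace K W V"
  obtains B where "finite B" "vectorspace.basis K (V\<lparr>carrier := W\<rparr>) B" "lin_indpt B"
    "B \<subseteq> W" "subdim K V W = card B"
proof -
  interpret W: vectorspace K "vs W" by (rule subspace_is_vs[OF W])
  have sm: "submodule K W V" using W by simp
  have WV: "W \<subseteq> carrier V" using subspaceD[OF W] by blast
  let ?P = "\<lambda>S. S \<subseteq> carrier (vs W) \<and> W.lin_indpt S"
  have P: "?P S \<longleftrightarrow> S \<subseteq> W \<and> lin_indpt S" for S
    using span_li_not_depend(2)[OF _ sm, of S] by auto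
  \<comment> \<open>Whether \<open>W\<close> has finite dimension is still open here. Independence
    in \<open>W\<close> and in \<open>V\<close> agree, so \<open>dim\<close> of \<open>V\<close>
    bounds the independent sets of \<open>W\<close>.\<close>
  have "\<exists>B. finite B \<and> maximal B ?P"
  proof (rule maximal_exists[where N = dim and B = "{}"])
    show "?P {}" unfolding P using finite_lin_indpt2[of "{}"] by auto
  qed (use P li_le_dim[OF fin_dim] WV in auto)
  then obtain B where B: "finite B" "maximal B ?P" by blast
  have "W.basis B" using W.max_li_is_basis[OF B(2)] .
  moreover have "W.dim = card B" using W.dim_basis[OF B(1) calculation] .
  moreover have "B \<subseteq> W \<and> lin_indpt B" using B(2) P unfolding maximal_def by blast
  ultimately show thesis using that B by blast
qed

lemma fin_dim_subspace:
  assumes "fin_dim_space K V" "subspace K W V"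
  shows "fin_dim_space K (V\<lparr>carrier := W\<rparr>)"
proof -
  interpret fin_dim_space K V by fact
  interpret W: vectorspace K "vs W" by (rule subspace_is_vs) fact
  obtain B where "finite B" "W.basis B" using subspace_basis[OF assms(2)] by metis
  then show ?thesis by unfold_locales (auto simp: W.fin_dim_def W.basis_def)
qed

lemma fin_dim_image:
  assumes f: "linear_map K V W f" and V: "fin_dim_space K V" and "f ` carrier V = carrier W"
  shows "fin_dim_space K W"
proof -
  interpret V: fin_dim_space K V by (rule V)
  interpret linear_map K V W f by (rule f)
  show ?thesis by unfold_locales (use surj_fin_dim[OF V.fin_dim assms(3)] in simp)
qed

lemma rank_nullity_subspace:
  assumes f: "linear_map K V W f" and V: "fin_dim_space K V" and U: "subspace K U V"
  shows "subdim K W (f ` U) + subdim K V {x \<in> U. f x = \<zero>\<^bsub>W\<^esub>} = subdim K V U"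
proof -
  interpret g: linear_map K "V\<lparr>carrier := U\<rparr>" W f by (rule linear_map_restrict_dom[OF f U])
  interpret U: fin_dim_space K "V\<lparr>carrier := U\<rparr>" by (rule fin_dim_subspace[OF V U])
  show ?thesis using g.rank_nullity[OF U.fin_dim] unfolding g.im_def g.ker_def by simp
qed

lemma subdim_zero: "vectorspace K V \<Longrightarrow> subdim K V {\<zero>\<^bsub>V\<^esub>} = 0"
proof -
  assume V: "vectorspace K V"
  interpret Z: vectorspace K "V\<lparr>carrier := {\<zero>\<^bsub>V\<^esub>}\<rparr>"
    by (rule vectorspace.subspace_is_vs[OF V subspace_zero[OF V]])
  have "Z.span {} = {\<zero>\<^bsub>V\<^esub>}" using Z.span_empty by simp
  then have "Z.gen_set {}" by simp
  then show ?thesis using Z.gen_ge_dim[of "{}"] by simp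
qed

text \<open>A basis of \<open>U\<close> stays independent in \<open>W\<close> and has at least dim
  \<open>W\<close> elements, so it spans \<open>W\<close> as well.\<close>

lemma subdim_eq_imp_eq:
  assumes V: "fin_dim_space K V" and U: "subspace K U V" and W: "subspace K W V"
    and "U \<subseteq> W" "subdim K V W \<le> subdim K V U"
  shows "U = W"
proof -
  interpret V: fin_dim_space K V by (rule V)
  interpret W: fin_dim_space K "V\<lparr>carrier := W\<rparr>" by (rule fin_dim_subspace[OF V W])
  interpret U: fin_dim_space K "V\<lparr>carrier := U\<rparr>" by (rule fin_dim_subspace[OF V U])
  have sm: "submodule K W V" "submodule K U V" using U W by auto
  obtain B where B: "finite B" "U.basis B" "V.lin_indpt B" "B \<subseteq> U" "U.dim = card B"
    using V.subspace_basis[OF U] by metis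
  have "W.lin_indpt B" using V.span_li_not_depend(2)[OF _ sm(1)] B assms(4) by blast
  then have "W.basis B"
    using W.dim_li_is_basis[OF W.fin_dim B(1)] B(4,5) assms(4,5) by auto
  then have "V.span B = W" using V.span_li_not_depend(1)[OF _ sm(1)] B(4) assms(4) by (auto simp: W.basis_def)
  moreover have "V.span B = U"
    using V.span_li_not_depend(1)[OF B(4) sm(2)] B(2) by (auto simp: U.basis_def)
  ultimately show ?thesis by blast
qed

lemma subdim_mono:
  assumes V: "fin_dim_space K V" and U: "subspace K U V" and W: "subspace K W V" and "U \<subseteq> W"
  shows "subdim K V U \<le> subdim K V W"
proof -
  interpret V: fin_dim_space K V by (rule V)
  interpret W: fin_dim_space K "V\<lparr>carrier := W\<rparr>" by (rule fin_dim_subspace[OF V W])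
  have sm: "submodule K W V" using W by auto
  obtain B where B: "finite B" "V.lin_indpt B" "B \<subseteq> U" "subdim K V U = card B"
    using V.subspace_basis[OF U] by metis
  have "W.lin_indpt B" using V.span_li_not_depend(2)[OF _ sm] B assms(4) by blast
  then show ?thesis using W.li_le_dim(2)[OF W.fin_dim] B assms(4) by auto
qed

section \<open>Quotient spaces\<close>

lemma abelian_subgroup_subspace:
  assumes "subspace K W V"
  shows "abelian_subgroup W V"
proof -
  interpret vectorspace K V using assms by (rule subspaceD)
  have "subgroup W (add_monoid V)"
    using subspaceD(2-4)[OF assms] subspace_neg[OF assms]
    by (intro subgroup.intro) (auto simp: a_inv_def)
  then show ?thesis
    using M.a_comm_group by (intro abelian_subgroupI2)
qed

context
  fixes K :: "('k, 'r) ring_scheme" and V :: "('k, 'v) module" and W :: "'v set"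
  assumes W: "subspace K W V"
begin

interpretation V: vectorspace K V using W by (rule subspaceD)
interpretation W: abelian_subgroup W V using W by (rule abelian_subgroup_subspace)

lemma coset_add:
  assumes "x \<in> carrier V" "y \<in> carrier V"
  shows "(W +>\<^bsub>V\<^esub> x) \<oplus>\<^bsub>quot_space V W\<^esub> (W +>\<^bsub>V\<^esub> y) = W +>\<^bsub>V\<^esub> (x \<oplus>\<^bsub>V\<^esub> y)"
  using W.a_rcos_sum[OF assms] by (simp add: quot_space_def)


lemma coset_eq_self_iff:
  assumes "x \<in> carrier V"
  shows "W +>\<^bsub>V\<^esub> x = W \<longleftrightarrow> x \<in> W"
  using W.a_rcos_const W.a_rcos_self[OF assms] by auto

text \<open>Scalar multiplication in \<open>quot_space\<close> and \<open>quot_map\<close> both have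
  this shape, so one computation shows that both act on representatives. Adding \<open>W\<close>
  absorbs the image of \<open>U\<close> and fills up the coset when that image is smaller than
  \<open>W\<close>.\<close>

lemma coset_image:
  assumes g: "linear_map K M V g" and U: "subspace K U M" and "g ` U \<subseteq> W" and x: "x \<in> carrier M"
  shows "(g ` (U +>\<^bsub>M\<^esub> x)) <+>\<^bsub>V\<^esub> W = W +>\<^bsub>V\<^esub> g x"
proof -
  have gx: "g x \<in> carrier V" using linear_mapD[OF g] x by blast
  have UM: "U \<subseteq> carrier M" using subspaceD[OF U] by blast
  have "g (u \<oplus>\<^bsub>M\<^esub> x) \<oplus>\<^bsub>V\<^esub> w = (g u \<oplus>\<^bsub>V\<^esub> w) \<oplus>\<^bsub>V\<^esub> g x \<and> g u \<oplus>\<^bsub>V\<^esub> w \<in> W"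
    if "u \<in> U" "w \<in> W" for u w
  proof -
    have u: "u \<in> carrier M" and w: "w \<in> carrier V" using that UM subspaceD(2)[OF W] by auto
    have "g u \<in> W" using assms(3) that by blast
    then show ?thesis
      using linear_mapD(3,4)[OF g] u w x subspaceD(4)[OF W] that by (simp add: V.M.a_ac)
  qed
  then have "(g ` (U +>\<^bsub>M\<^esub> x)) <+>\<^bsub>V\<^esub> W \<subseteq> W +>\<^bsub>V\<^esub> g x"
    by (fastforce simp: set_add_def' a_r_coset_def')
  moreover have "W +>\<^bsub>V\<^esub> g x \<subseteq> (g ` (U +>\<^bsub>M\<^esub> x)) <+>\<^bsub>V\<^esub> W"
  proof
    fix y assume "y \<in> W +>\<^bsub>V\<^esub> g x"
    then obtain w where w: "w \<in> W" "y = w \<oplus>\<^bsub>V\<^esub> g x" by (auto simp: a_r_coset_def')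
    interpret M: vectorspace K M using g by (rule linear_mapD)
    have "x = \<zero>\<^bsub>M\<^esub> \<oplus>\<^bsub>M\<^esub> x" using x by simp
    then have "x \<in> U +>\<^bsub>M\<^esub> x" using subspaceD(3)[OF U] unfolding a_r_coset_def' by blast
    moreover have "y = g x \<oplus>\<^bsub>V\<^esub> w" using w gx subspaceD(2)[OF W] by (auto simp: V.M.a_comm)
    ultimately show "y \<in> (g ` (U +>\<^bsub>M\<^esub> x)) <+>\<^bsub>V\<^esub> W" using w(1) by (auto simp: set_add_def')
  qed
  ultimately show ?thesis by blast
qed

end

context
  fixes K :: "('k, 'r) ring_scheme" and V :: "('k, 'v) module" and W :: "'v set"
  assumes W: "subspace K W V"
begin

interpretation V: vectorspace K V using W by (rule subspaceD)
interpretation W: abelian_subgroup W V using W by (rule abelian_subgroup_subspace)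

lemma coset_smult:
  assumes c: "c \<in> carrier K" and x: "x \<in> carrier V"
  shows "c \<odot>\<^bsub>quot_space V W\<^esub> (W +>\<^bsub>V\<^esub> x) = W +>\<^bsub>V\<^esub> (c \<odot>\<^bsub>V\<^esub> x)"
proof -
  \<comment> \<open>Multiplication by \<open>c\<close> is linear and maps \<open>W\<close> into
    itself, so \<open>coset_image\<close> applies with \<open>U = W\<close>.\<close>
  have "linear_map K V V (\<lambda>x. c \<odot>\<^bsub>V\<^esub> x)"
    by (intro linear_mapI V.vectorspace_axioms)
      (use c in \<open>auto simp: V.smult_r_distr V.smult_assoc1[symmetric] V.R.m_comm\<close>)
  from coset_image[OF W this W _ x] show ?thesis
    using subspaceD(5)[OF W c] by (auto simp: quot_space_def)
qed

lemma carrier_quot_space: "carrier (quot_space V W) = (\<lambda>x. W +>\<^bsub>V\<^esub> x) ` carrier V"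
  by (auto simp: quot_space_def A_RCOSETS_def')

lemma vectorspace_quot_space: "vectorspace K (quot_space V W)"
proof -
  let ?Q = "quot_space V W"
  have zero: "\<zero>\<^bsub>?Q\<^esub> = W +>\<^bsub>V\<^esub> \<zero>\<^bsub>V\<^esub>"
    using W.a_rcos_const[OF subspaceD(3)[OF W]] by (simp add: quot_space_def)
  have inv: "\<exists>y\<in>carrier V. W +>\<^bsub>V\<^esub> (x \<oplus>\<^bsub>V\<^esub> y) = W +>\<^bsub>V\<^esub> \<zero>\<^bsub>V\<^esub>" if "x \<in> carrier V" for x
    using that by (intro bexI[where x = "\<ominus>\<^bsub>V\<^esub> x"]) (simp_all add: V.M.r_neg)
  have ab: "abelian_group ?Q"
    by (rule abelian_groupI)
      (auto simp: carrier_quot_space zero coset_add[OF W] V.M.a_ac inv)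
  have "module_axioms K ?Q"
    unfolding module_axioms_def carrier_quot_space
    by (auto simp: coset_add[OF W] coset_smult V.smult_l_distr V.smult_r_distr V.smult_assoc1)
  then show ?thesis
    using ab V.vectorspace_axioms unfolding vectorspace_def module_def by blast
qed

lemma linear_map_coset: "linear_map K V (quot_space V W) (\<lambda>x. W +>\<^bsub>V\<^esub> x)"
  by (intro linear_mapI vectorspace_quot_space V.vectorspace_axioms)
    (auto simp: carrier_quot_space coset_add[OF W] coset_smult)

lemma fin_dim_quot_space: "fin_dim_space K V \<Longrightarrow> fin_dim_space K (quot_space V W)"
  by (rule fin_dim_image[OF linear_map_coset]) (simp_all add: carrier_quot_space)

lemma zero_quot_space: "\<zero>\<^bsub>quot_space V W\<^esub> = W"
  by (simp add: quot_space_def)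

text \<open>Rank-nullity for the projection restricted to \<open>U\<close>; its kernel is the
  intersection with \<open>W\<close>.\<close>

lemma dim_coset_image:
  assumes V: "fin_dim_space K V" and U: "subspace K U V"
  shows "subdim K (quot_space V W) ((\<lambda>x. W +>\<^bsub>V\<^esub> x) ` U) + subdim K V (U \<inter> W) = subdim K V U"
proof -
  have "{x \<in> U. W +>\<^bsub>V\<^esub> x = W} = U \<inter> W"
    using coset_eq_self_iff[OF W] subspaceD(2)[OF U] by auto
  then show ?thesis
    using rank_nullity_subspace[OF linear_map_coset V U] by (simp add: zero_quot_space)
qed

lemma dim_quot_space:
  assumes V: "fin_dim_space K V"
  shows "vectorspace.dim K (quot_space V W) + subdim K V W = vectorspace.dim K V"
proof -
  have "carrier V \<inter> W = W" using subspaceD(2)[OF W] by blast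
  then show ?thesis
    using dim_coset_image[OF V subspace_carrier[OF V.vectorspace_axioms]]
    by (simp flip: carrier_quot_space)
qed

end

section \<open>Kernels and cokernels of maps induced on quotients\<close>

context
  fixes K :: "('k, 'r) ring_scheme" and M :: "('k, 'm) module" and N :: "('k, 'n) module"
    and f :: "'m \<Rightarrow> 'n" and U :: "'m set" and W :: "'n set"
  assumes f: "linear_map K M N f" and U: "subspace K U M" and W: "subspace K W N"
    and fU: "f ` U \<subseteq> W"
begin

lemma quot_map_coset:
  "x \<in> carrier M \<Longrightarrow> quot_map N W f (U +>\<^bsub>M\<^esub> x) = W +>\<^bsub>N\<^esub> f x"
  unfolding quot_map_def by (rule coset_image[OF W f U fU])

lemma linear_map_quot_map: "linear_map K (quot_space M U) (quot_space N W) (quot_map N W f)"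
proof -
  interpret M: vectorspace K M using f by (rule linear_mapD)
  show ?thesis
    by (intro linear_mapI vectorspace_quot_space U W)
      (auto simp: carrier_quot_space[OF U] carrier_quot_space[OF W] coset_add[OF U] coset_add[OF W]
        coset_smult[OF U] coset_smult[OF W] quot_map_coset linear_mapD(3-5)[OF f])
qed

text \<open>The kernel is the projection of the preimage of \<open>W\<close>, and this preimage
  contains \<open>U\<close>.\<close>

lemma dim_ker_quot_map:
  assumes M: "fin_dim_space K M"
  shows "vectorspace.dim K (ker_space (quot_space M U) (quot_space N W) (quot_map N W f)) + subdim K M U
    = subdim K M {x \<in> carrier M. f x \<in> W}"
proof -
  interpret q: linear_map K "quot_space M U" "quot_space N W" "quot_map N W f"
    by (rule linear_map_quot_map)
  let ?P = "{x \<in> carrier M. f x \<in> W}"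
  have key: "quot_map N W f (U +>\<^bsub>M\<^esub> x) = W \<longleftrightarrow> f x \<in> W" if "x \<in> carrier M" for x
    using that by (simp add: quot_map_coset coset_eq_self_iff[OF W] linear_mapD(3)[OF f])
  have "mod_hom.ker (quot_space M U) (quot_space N W) (quot_map N W f) = (\<lambda>x. U +>\<^bsub>M\<^esub> x) ` ?P"
    unfolding q.ker_def carrier_quot_space[OF U] zero_quot_space[OF W]
    using key by force
  moreover have "?P \<inter> U = U" using fU subspaceD(2)[OF U] by blast
  ultimately show ?thesis
    using dim_coset_image[OF U M subspace_preimage[OF f W]] by (simp add: ker_space_def)
qed

text \<open>Rank-nullity for the induced map reduces the cokernel to the kernel computed above. The
  identity is additive because dimensions are natural numbers.\<close>

lemma dim_coker_quot_map:
  assumes M: "fin_dim_space K M" and N: "fin_dim_space K N"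
  shows "vectorspace.dim K (coker_space (quot_space M U) (quot_space N W) (quot_map N W f))
      + subdim K N W + vectorspace.dim K M
    = vectorspace.dim K N + subdim K M {x \<in> carrier M. f x \<in> W}"
proof -
  interpret q: linear_map K "quot_space M U" "quot_space N W" "quot_map N W f"
    by (rule linear_map_quot_map)
  interpret MU: fin_dim_space K "quot_space M U" by (rule fin_dim_quot_space[OF U M])
  note NW = fin_dim_quot_space[OF W N]
  show ?thesis
    using dim_quot_space[OF q.imT_is_subspace NW] q.rank_nullity[OF MU.fin_dim]
      dim_ker_quot_map[OF M] dim_quot_space[OF U M] dim_quot_space[OF W N]
    unfolding coker_space_def ker_space_def by linarith
qed

end

section \<open>Dual spaces and annihilators\<close>

lemma vectorspace_self_module:
  assumes "field K"
  shows "vectorspace K (self_module K)"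
proof -
  interpret field K by fact
  show ?thesis
    by (rule vs_criteria[OF assms])
      (auto simp: self_module_def a_ac l_distr r_distr m_assoc intro: r_neg)
qed

lemma self_module_simps [simp]:
  "carrier (self_module K) = carrier K" "\<zero>\<^bsub>self_module K\<^esub> = \<zero>\<^bsub>K\<^esub>"
  "x \<oplus>\<^bsub>self_module K\<^esub> y = x \<oplus>\<^bsub>K\<^esub> y" "c \<odot>\<^bsub>self_module K\<^esub> y = c \<otimes>\<^bsub>K\<^esub> y"
  by (simp_all add: self_module_def)

lemma finsum_self_module: "finsum (self_module K) f A = finsum K f A"
  by (simp add: finsum_def finprod_def self_module_def)

context
  fixes K :: "('k, 'r) ring_scheme" and V :: "('k, 'v) module"
  assumes V: "vectorspace K V"
begin

interpretation V: vectorspace K V by (rule V)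
interpretation F: vectorspace K "V.R.func_space (carrier V)" by (rule V.func_space_is_vs)

lemma carrier_dual_space:
  "carrier (dual_space K V) = {\<phi>. linear_map K V (self_module K) \<phi> \<and> \<phi> \<in> extensional (carrier V)}"
  using V vectorspace_self_module[OF V.field_axioms]
  by (auto simp: dual_space_def linear_map_def mod_hom_def mod_hom_axioms_def vectorspace_def)

lemma dual_space_simps:
  "\<zero>\<^bsub>dual_space K V\<^esub> = (\<lambda>x\<in>carrier V. \<zero>\<^bsub>K\<^esub>)"
  "\<phi> \<oplus>\<^bsub>dual_space K V\<^esub> \<psi> = (\<lambda>x\<in>carrier V. \<phi> x \<oplus>\<^bsub>K\<^esub> \<psi> x)"
  "c \<odot>\<^bsub>dual_space K V\<^esub> \<phi> = (\<lambda>x\<in>carrier V. c \<otimes>\<^bsub>K\<^esub> \<phi> x)"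
  by (simp_all add: dual_space_def V.R.func_space_def)

lemma dual_spaceI:
  assumes "\<phi> \<in> extensional (carrier V)"
    and "\<And>x. x \<in> carrier V \<Longrightarrow> \<phi> x \<in> carrier K"
    and "\<And>x y. x \<in> carrier V \<Longrightarrow> y \<in> carrier V \<Longrightarrow> \<phi> (x \<oplus>\<^bsub>V\<^esub> y) = \<phi> x \<oplus>\<^bsub>K\<^esub> \<phi> y"
    and "\<And>c x. c \<in> carrier K \<Longrightarrow> x \<in> carrier V \<Longrightarrow> \<phi> (c \<odot>\<^bsub>V\<^esub> x) = c \<otimes>\<^bsub>K\<^esub> \<phi> x"
  shows "\<phi> \<in> carrier (dual_space K V)"
  unfolding carrier_dual_space using assms
  by (auto intro!: linear_mapI V vectorspace_self_module V.field_axioms)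

lemma dual_spaceD:
  assumes "\<phi> \<in> carrier (dual_space K V)"
  shows "x \<in> carrier V \<Longrightarrow> \<phi> x \<in> carrier K"
    and "x \<in> carrier V \<Longrightarrow> y \<in> carrier V \<Longrightarrow> \<phi> (x \<oplus>\<^bsub>V\<^esub> y) = \<phi> x \<oplus>\<^bsub>K\<^esub> \<phi> y"
    and "c \<in> carrier K \<Longrightarrow> x \<in> carrier V \<Longrightarrow> \<phi> (c \<odot>\<^bsub>V\<^esub> x) = c \<otimes>\<^bsub>K\<^esub> \<phi> x"
    and "\<phi> \<zero>\<^bsub>V\<^esub> = \<zero>\<^bsub>K\<^esub>"
    and "linear_map K V (self_module K) \<phi>"
    and "\<phi> \<in> extensional (carrier V)"
  using assms linear_mapD[of K V "self_module K" \<phi>] unfolding carrier_dual_space by auto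

lemma vectorspace_dual_space: "vectorspace K (dual_space K V)"
proof -
  \<comment> \<open>The dual carries the operations of the function space on
    \<open>carrier V\<close>, so the vector space laws are inherited once the linear forms are seen
    to be closed under them.\<close>
  have "subspace K (carrier (dual_space K V)) (V.R.func_space (carrier V))"
  proof (rule subspaceI[OF F.vectorspace_axioms])
    show "carrier (dual_space K V) \<subseteq> carrier (V.R.func_space (carrier V))"
      using dual_spaceD(1,6) by (simp add: V.R.func_space_def PiE_iff subset_iff)
    show "\<zero>\<^bsub>V.R.func_space (carrier V)\<^esub> \<in> carrier (dual_space K V)"
      by (rule dual_spaceI) (auto simp: V.R.func_space_def)
    show "\<phi> \<oplus>\<^bsub>V.R.func_space (carrier V)\<^esub> \<psi> \<in> carrier (dual_space K V)"
      if "\<phi> \<in> carrier (dual_space K V)" "\<psi> \<in> carrier (dual_space K V)" for \<phi> \<psi>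
      by (rule dual_spaceI)
        (use dual_spaceD[OF that(1)] dual_spaceD[OF that(2)]
          in \<open>auto simp: V.R.func_space_def V.R.a_ac V.R.r_distr\<close>)
    show "c \<odot>\<^bsub>V.R.func_space (carrier V)\<^esub> \<phi> \<in> carrier (dual_space K V)"
      if "c \<in> carrier K" "\<phi> \<in> carrier (dual_space K V)" for c \<phi>
      by (rule dual_spaceI)
        (use dual_spaceD[OF that(2)] that(1)
          in \<open>auto simp: V.R.func_space_def V.R.m_ac V.R.r_distr\<close>)
  qed
  from F.subspace_is_vs[OF this] show ?thesis by (simp add: dual_space_def)
qed

end

definition annihilator :: "('k, 'r) ring_scheme \<Rightarrow> ('k, 'v) module \<Rightarrow> 'v set \<Rightarrow> ('v \<Rightarrow> 'k) set" where
  "annihilator K V U = {\<phi> \<in> carrier (dual_space K V). \<forall>u\<in>U. \<phi> u = \<zero>\<^bsub>K\<^esub>}"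

lemma subspace_annihilator:
  assumes V: "vectorspace K V" and U: "U \<subseteq> carrier V"
  shows "subspace K (annihilator K V U) (dual_space K V)"
proof -
  interpret V: vectorspace K V by (rule V)
  interpret D: vectorspace K "dual_space K V" by (rule vectorspace_dual_space[OF V])
  show ?thesis
  proof (rule subspaceI[OF D.vectorspace_axioms])
    show "\<zero>\<^bsub>dual_space K V\<^esub> \<in> annihilator K V U"
      using U D.M.zero_closed by (auto simp: annihilator_def dual_space_simps[OF V])
    show "\<phi> \<oplus>\<^bsub>dual_space K V\<^esub> \<psi> \<in> annihilator K V U"
      if "\<phi> \<in> annihilator K V U" "\<psi> \<in> annihilator K V U" for \<phi> \<psi>
      using that U D.M.a_closed[of \<phi> \<psi>] by (auto simp: annihilator_def dual_space_simps[OF V])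
    show "c \<odot>\<^bsub>dual_space K V\<^esub> \<phi> \<in> annihilator K V U"
      if "c \<in> carrier K" "\<phi> \<in> annihilator K V U" for c \<phi>
      using that U D.smult_closed[of c \<phi>] by (auto simp: annihilator_def dual_space_simps[OF V])
  qed (auto simp: annihilator_def)
qed

lemma annihilator_zero:
  assumes V: "vectorspace K V"
  shows "annihilator K V {\<zero>\<^bsub>V\<^esub>} = carrier (dual_space K V)"
  using dual_spaceD(4)[OF V] by (auto simp: annihilator_def)

lemma annihilator_carrier:
  assumes V: "vectorspace K V"
  shows "annihilator K V (carrier V) = {\<zero>\<^bsub>dual_space K V\<^esub>}"
proof -
  interpret V: vectorspace K V by (rule V)
  interpret D: vectorspace K "dual_space K V" by (rule vectorspace_dual_space[OF V])
  have "\<phi> = \<zero>\<^bsub>dual_space K V\<^esub>" if "\<phi> \<in> annihilator K V (carrier V)" for \<phi>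
  proof (rule extensionalityI[where A = "carrier V"])
    show "\<phi> \<in> extensional (carrier V)"
      using that dual_spaceD(6)[OF V] by (auto simp: annihilator_def)
  qed (use that in \<open>auto simp: annihilator_def dual_space_simps[OF V]\<close>)
  then show ?thesis
    using subspaceD(3)[OF subspace_annihilator[OF V order_refl]] by blast
qed

section \<open>Coordinates and the dimension of the dual space\<close>

lemma (in vectorspace) lincomb_unit:
  assumes "finite S" "S \<subseteq> carrier V" "v \<in> S"
  shows "lincomb (\<lambda>w. if w = v then \<one>\<^bsub>K\<^esub> else \<zero>\<^bsub>K\<^esub>) S = v"
proof -
  let ?a = "\<lambda>w. if w = v then \<one>\<^bsub>K\<^esub> else \<zero>\<^bsub>K\<^esub>"
  have "lincomb ?a (S - {v}) = \<zero>\<^bsub>V\<^esub>" using assms by (intro lincomb_zero) auto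
  then show ?thesis using lincomb_del2[of S ?a v] assms by auto
qed

lemma (in vectorspace) basis_coordinates:
  assumes C: "finite C" "basis C"
  obtains \<delta> where "\<And>c. c \<in> C \<Longrightarrow> linear_map K V (self_module K) (\<delta> c)"
    and "\<And>x. x \<in> carrier V \<Longrightarrow> lincomb (\<lambda>c. \<delta> c x) C = x"
    and "\<And>a c. a \<in> C \<rightarrow> carrier K \<Longrightarrow> c \<in> C \<Longrightarrow> \<delta> c (lincomb a C) = a c"
proof -
  have CV: "C \<subseteq> carrier V" using C by (simp add: basis_def)
  \<comment> \<open>Coefficients are unique only as functions with a fixed value outside
    \<open>C\<close>; hence the extensional functions here and \<open>restrict a C\<close>
    below.\<close>
  have ex1: "\<exists>!a. a \<in> C \<rightarrow>\<^sub>E carrier K \<and> lincomb a C = x" if "x \<in> carrier V" for x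
    using basis_criterion[OF C(1) CV] C(2) that by blast
  define A where "A x = (THE a. a \<in> C \<rightarrow>\<^sub>E carrier K \<and> lincomb a C = x)" for x
  have A: "A x \<in> C \<rightarrow>\<^sub>E carrier K" "lincomb (A x) C = x" if "x \<in> carrier V" for x
    using theI'[OF ex1[OF that]] unfolding A_def by auto
  have uniq: "A (lincomb a C) c = a c" if a: "a \<in> C \<rightarrow> carrier K" and c: "c \<in> C" for a c
  proof -
    have "lincomb (restrict a C) C = lincomb a C"
      by (rule lincomb_cong) (use a CV in auto)
    moreover have "lincomb a C \<in> carrier V" using a CV by auto
    moreover have "restrict a C \<in> C \<rightarrow>\<^sub>E carrier K" using a by auto
    ultimately have "A (lincomb a C) = restrict a C" using ex1 A by metis
    then show ?thesis using c by simp
  qed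
  have AK: "A x \<in> C \<rightarrow> carrier K" if "x \<in> carrier V" for x using A(1)[OF that] by auto
  show thesis
  proof (rule that[of "\<lambda>c x. A x c"])
    show "linear_map K V (self_module K) (\<lambda>x. A x c)" if c: "c \<in> C" for c
    proof (rule linear_mapI)
      show "vectorspace K V" by (rule vectorspace_axioms)
      show "vectorspace K (self_module K)" by (rule vectorspace_self_module[OF field_axioms])
      show "(\<lambda>x. A x c) \<in> carrier V \<rightarrow> carrier (self_module K)"
        using AK c by auto
      fix x y assume x: "x \<in> carrier V" and y: "y \<in> carrier V"
      have "lincomb (\<lambda>c. A x c \<oplus>\<^bsub>K\<^esub> A y c) C = x \<oplus>\<^bsub>V\<^esub> y"
        using lincomb_sum[OF C(1) CV AK[OF x] AK[OF y]] A(2) x y by simp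
      moreover have "(\<lambda>c. A x c \<oplus>\<^bsub>K\<^esub> A y c) \<in> C \<rightarrow> carrier K" using AK x y by blast
      ultimately show "A (x \<oplus>\<^bsub>V\<^esub> y) c = A x c \<oplus>\<^bsub>self_module K\<^esub> A y c"
        using uniq[of "\<lambda>c. A x c \<oplus>\<^bsub>K\<^esub> A y c" c] c by simp
    next
      fix k x assume k: "k \<in> carrier K" and x: "x \<in> carrier V"
      have "lincomb (\<lambda>c. k \<otimes>\<^bsub>K\<^esub> A x c) C = k \<odot>\<^bsub>V\<^esub> x"
        using lincomb_smult[OF CV AK[OF x] k] A(2) x by simp
      moreover have "(\<lambda>c. k \<otimes>\<^bsub>K\<^esub> A x c) \<in> C \<rightarrow> carrier K" using AK x k by blast
      ultimately show "A (k \<odot>\<^bsub>V\<^esub> x) c = k \<odot>\<^bsub>self_module K\<^esub> A x c"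
        using uniq[of "\<lambda>c. k \<otimes>\<^bsub>K\<^esub> A x c" c] c by simp
    qed
    show "lincomb (A x) C = x" if "x \<in> carrier V" for x using A(2)[OF that] by simp
  qed (rule uniq)
qed

context
  fixes K :: "('k, 'r) ring_scheme" and V :: "('k, 'v) module"
  assumes V: "fin_dim_space K V"
begin

interpretation V: fin_dim_space K V by (rule V)

lemma dual_apply_lincomb:
  assumes \<phi>: "\<phi> \<in> carrier (dual_space K V)" and S: "finite S" "S \<subseteq> carrier V" and a: "a \<in> S \<rightarrow> carrier K"
  shows "\<phi> (V.lincomb a S) = (\<Oplus>\<^bsub>K\<^esub>c\<in>S. a c \<otimes>\<^bsub>K\<^esub> \<phi> c)"
proof -
  interpret l: linear_map K V "self_module K" \<phi> using \<phi> by (rule dual_spaceD[OF V.vectorspace_axioms])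
  have "\<phi> (V.lincomb a S) = (\<Oplus>\<^bsub>self_module K\<^esub>c\<in>S. \<phi> (a c \<odot>\<^bsub>V\<^esub> c))"
    unfolding V.lincomb_def by (rule l.hom_sum) (use S a in auto)
  also have "\<dots> = (\<Oplus>\<^bsub>K\<^esub>c\<in>S. \<phi> (a c \<odot>\<^bsub>V\<^esub> c))" by (rule finsum_self_module)
  also have "\<dots> = (\<Oplus>\<^bsub>K\<^esub>c\<in>S. a c \<otimes>\<^bsub>K\<^esub> \<phi> c)"
    using S a dual_spaceD(1,3)[OF V.vectorspace_axioms \<phi>]
    by (intro V.R.finsum_cong') (auto simp: Pi_iff subset_iff)
  finally show ?thesis .
qed

text \<open>Prepares \<open>dim_annihilator_aux\<close>: when \<open>S\<close> is a basis of a
  subspace, this map has that subspace as its image and the annihilator as its kernel.\<close>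

lemma dual_lincomb_linear:
  assumes S: "finite S" "S \<subseteq> carrier V"
  shows "linear_map K (dual_space K V) V (\<lambda>\<phi>. V.lincomb \<phi> S)"
proof -
  note D = dual_spaceD[OF V.vectorspace_axioms]
  show ?thesis
  proof (rule linear_mapI[OF vectorspace_dual_space[OF V.vectorspace_axioms] V.vectorspace_axioms])
    show "(\<lambda>\<phi>. V.lincomb \<phi> S) \<in> carrier (dual_space K V) \<rightarrow> carrier V"
      using S D(1) by (auto intro!: V.lincomb_closed)
    fix \<phi> \<psi> assume \<phi>: "\<phi> \<in> carrier (dual_space K V)" and \<psi>: "\<psi> \<in> carrier (dual_space K V)"
    have p: "\<phi> \<in> S \<rightarrow> carrier K" "\<psi> \<in> S \<rightarrow> carrier K" using D(1)[OF \<phi>] D(1)[OF \<psi>] S by auto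
    have "V.lincomb (\<phi> \<oplus>\<^bsub>dual_space K V\<^esub> \<psi>) S = V.lincomb (\<lambda>v. \<phi> v \<oplus>\<^bsub>K\<^esub> \<psi> v) S"
      by (rule V.lincomb_cong) (use S p in \<open>auto simp: dual_space_simps[OF V.vectorspace_axioms]\<close>)
    then show "V.lincomb (\<phi> \<oplus>\<^bsub>dual_space K V\<^esub> \<psi>) S = V.lincomb \<phi> S \<oplus>\<^bsub>V\<^esub> V.lincomb \<psi> S"
      using V.lincomb_sum[OF S p] by simp
  next
    fix k \<phi> assume k: "k \<in> carrier K" and \<phi>: "\<phi> \<in> carrier (dual_space K V)"
    have p: "\<phi> \<in> S \<rightarrow> carrier K" using D(1)[OF \<phi>] S by auto
    have "V.lincomb (k \<odot>\<^bsub>dual_space K V\<^esub> \<phi>) S = V.lincomb (\<lambda>v. k \<otimes>\<^bsub>K\<^esub> \<phi> v) S"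
      by (rule V.lincomb_cong) (use S p k in \<open>auto simp: dual_space_simps[OF V.vectorspace_axioms]\<close>)
    then show "V.lincomb (k \<odot>\<^bsub>dual_space K V\<^esub> \<phi>) S = k \<odot>\<^bsub>V\<^esub> V.lincomb \<phi> S"
      using V.lincomb_smult[OF S(2) p k] by simp
  qed
qed

text \<open>A basis of \<open>V\<close> defines a nondegenerate symmetric bilinear form and thus a map of \<open>V\<close> onto its dual.\<close>

lemma fin_dim_dual_space: "fin_dim_space K (dual_space K V)"
proof -
  note D = dual_spaceD[OF V.vectorspace_axioms]
  obtain C where C: "finite C" "V.basis C" using V.finite_basis_exists[OF V.fin_dim] by blast
  have CV: "C \<subseteq> carrier V" using C by (simp add: V.basis_def)
  obtain \<delta> where \<delta>: "\<And>c. c \<in> C \<Longrightarrow> linear_map K V (self_module K) (\<delta> c)"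
    and coord: "\<And>x. x \<in> carrier V \<Longrightarrow> V.lincomb (\<lambda>c. \<delta> c x) C = x"
    and coeff: "\<And>a c. a \<in> C \<rightarrow> carrier K \<Longrightarrow> c \<in> C \<Longrightarrow> \<delta> c (V.lincomb a C) = a c"
    by (rule V.basis_coordinates[OF C]) blast
  have \<delta>K: "\<delta> c x \<in> carrier K" if "c \<in> C" "x \<in> carrier V" for c x
    using linear_mapD(3)[OF \<delta>] that by auto
  define b where "b x y = (\<Oplus>\<^bsub>K\<^esub>c\<in>C. \<delta> c x \<otimes>\<^bsub>K\<^esub> \<delta> c y)" for x y
  have bK: "b x y \<in> carrier K" if "x \<in> carrier V" "y \<in> carrier V" for x y
    unfolding b_def using \<delta>K that by (intro V.R.finsum_closed) auto
  have b_comm: "b x y = b y x" if "x \<in> carrier V" "y \<in> carrier V" for x y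
    unfolding b_def using \<delta>K that by (intro V.R.finsum_cong') (auto simp: V.R.m_comm)
  have b_add: "b x (y \<oplus>\<^bsub>V\<^esub> z) = b x y \<oplus>\<^bsub>K\<^esub> b x z"
    if "x \<in> carrier V" "y \<in> carrier V" "z \<in> carrier V" for x y z
  proof -
    have "b x (y \<oplus>\<^bsub>V\<^esub> z) = (\<Oplus>\<^bsub>K\<^esub>c\<in>C. \<delta> c x \<otimes>\<^bsub>K\<^esub> \<delta> c y \<oplus>\<^bsub>K\<^esub> \<delta> c x \<otimes>\<^bsub>K\<^esub> \<delta> c z)"
      unfolding b_def using \<delta>K that linear_mapD(4)[OF \<delta>]
      by (intro V.R.finsum_cong') (auto simp: V.R.r_distr)
    also have "\<dots> = b x y \<oplus>\<^bsub>K\<^esub> b x z"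
      unfolding b_def using \<delta>K that by (intro V.R.finsum_addf) auto
    finally show ?thesis .
  qed
  have b_smult: "b x (k \<odot>\<^bsub>V\<^esub> y) = k \<otimes>\<^bsub>K\<^esub> b x y"
    if "x \<in> carrier V" "y \<in> carrier V" "k \<in> carrier K" for x y k
  proof -
    have "b x (k \<odot>\<^bsub>V\<^esub> y) = (\<Oplus>\<^bsub>K\<^esub>c\<in>C. k \<otimes>\<^bsub>K\<^esub> (\<delta> c x \<otimes>\<^bsub>K\<^esub> \<delta> c y))"
      unfolding b_def using \<delta>K that linear_mapD(5)[OF \<delta>]
      by (intro V.R.finsum_cong') (auto simp: V.R.m_lcomm)
    also have "\<dots> = k \<otimes>\<^bsub>K\<^esub> b x y"
      unfolding b_def using \<delta>K that C(1) by (intro V.R.finsum_rdistr[symmetric]) auto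
    finally show ?thesis .
  qed
  let ?\<beta> = "\<lambda>x. \<lambda>y\<in>carrier V. b x y"
  have \<beta>: "?\<beta> x \<in> carrier (dual_space K V)" if "x \<in> carrier V" for x
    by (rule dual_spaceI[OF V.vectorspace_axioms]) (use that bK b_add b_smult in auto)
  have b_add': "b (x \<oplus>\<^bsub>V\<^esub> y) z = b x z \<oplus>\<^bsub>K\<^esub> b y z"
    if "x \<in> carrier V" "y \<in> carrier V" "z \<in> carrier V" for x y z
    using b_comm b_add that by simp
  have b_smult': "b (k \<odot>\<^bsub>V\<^esub> x) y = k \<otimes>\<^bsub>K\<^esub> b x y"
    if "x \<in> carrier V" "y \<in> carrier V" "k \<in> carrier K" for x y k
    using b_comm b_smult that by simp
  have lin: "linear_map K V (dual_space K V) ?\<beta>"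
    by (rule linear_mapI[OF V.vectorspace_axioms vectorspace_dual_space[OF V.vectorspace_axioms]])
      (use \<beta> b_add' b_smult' in
        \<open>auto simp: dual_space_simps[OF V.vectorspace_axioms] intro!: restrict_ext\<close>)
  have "carrier (dual_space K V) \<subseteq> ?\<beta> ` carrier V"
  proof
    fix \<phi> assume \<phi>: "\<phi> \<in> carrier (dual_space K V)"
    then have p: "\<phi> \<in> C \<rightarrow> carrier K" using D(1)[OF \<phi>] CV by auto
    then have v: "V.lincomb \<phi> C \<in> carrier V" using CV by auto
    \<comment> \<open>The vector whose coordinates are the values of \<phi> on the basis represents
      \<phi>.\<close>
    have "\<phi> = ?\<beta> (V.lincomb \<phi> C)"
    proof (rule extensionalityI[OF D(6)[OF \<phi>]])
      fix y assume y: "y \<in> carrier V"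
      have "\<phi> y = \<phi> (V.lincomb (\<lambda>c. \<delta> c y) C)" using coord[OF y] by simp
      also have "\<dots> = (\<Oplus>\<^bsub>K\<^esub>c\<in>C. \<delta> c y \<otimes>\<^bsub>K\<^esub> \<phi> c)"
        by (rule dual_apply_lincomb[OF \<phi> C(1) CV]) (use \<delta>K y in auto)
      also have "\<dots> = b (V.lincomb \<phi> C) y"
        unfolding b_def using p \<delta>K y
        by (intro V.R.finsum_cong') (auto simp: coeff[OF p] Pi_iff V.R.m_comm)
      finally show "\<phi> y = ?\<beta> (V.lincomb \<phi> C) y" using y by simp
    qed auto
    then show "\<phi> \<in> ?\<beta> ` carrier V" using v by blast
  qed
  then show ?thesis using fin_dim_image[OF lin V] \<beta> by blast
qed

text \<open>Rank-nullity for the map that sends \<phi> to the sum of \<phi>(b) b over a basis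
  \<open>B\<close> of \<open>U\<close>.\<close>

lemma dim_annihilator_aux:
  assumes U: "subspace K U V"
  shows "subdim K (dual_space K V) (annihilator K V U) + subdim K V U
    = vectorspace.dim K (dual_space K V)"
proof -
  note D = dual_spaceD[OF V.vectorspace_axioms]
  interpret U: vectorspace K "V\<lparr>carrier := U\<rparr>" by (rule V.subspace_is_vs[OF U])
  have sm: "submodule K U V" using U by simp
  have UV: "U \<subseteq> carrier V" using subspaceD[OF U] by blast
  obtain B where B: "finite B" "U.basis B" "V.lin_indpt B" "B \<subseteq> U"
    using V.subspace_basis[OF U] by metis
  have BV: "B \<subseteq> carrier V" using B UV by blast
  have span: "V.span B = U"
    using V.span_li_not_depend(1)[OF B(4) sm] B(2) by (auto simp: U.basis_def)
  \<comment> \<open>The basis is extended to all of \<open>V\<close> so that its coordinate forms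
    are defined on \<open>V\<close>; those that belong to \<open>B\<close> yield preimages of the
    elements of \<open>B\<close>.\<close>
  obtain C where C: "B \<subseteq> C" "finite C" "V.basis C"
    using V.li_extend_to_basis[OF V.fin_dim B(3) BV] by blast
  have CV: "C \<subseteq> carrier V" using C by (simp add: V.basis_def)
  obtain \<delta> where \<delta>: "\<And>c. c \<in> C \<Longrightarrow> linear_map K V (self_module K) (\<delta> c)"
    and coeff: "\<And>a c. a \<in> C \<rightarrow> carrier K \<Longrightarrow> c \<in> C \<Longrightarrow> \<delta> c (V.lincomb a C) = a c"
    by (rule V.basis_coordinates[OF C(2,3)]) blast
  let ?\<Psi> = "\<lambda>\<phi>. V.lincomb \<phi> B"
  have lin: "linear_map K (dual_space K V) V ?\<Psi>" by (rule dual_lincomb_linear[OF B(1) BV])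
  interpret l: linear_map K "dual_space K V" V ?\<Psi> by (rule lin)
  have dK: "\<phi> \<in> B \<rightarrow> carrier K" if "\<phi> \<in> carrier (dual_space K V)" for \<phi>
    using D(1)[OF that] BV by auto
  have ker: "{\<phi> \<in> carrier (dual_space K V). ?\<Psi> \<phi> = \<zero>\<^bsub>V\<^esub>} = annihilator K V U"
  proof (rule equalityI; rule subsetI)
    fix \<phi> assume "\<phi> \<in> {\<phi> \<in> carrier (dual_space K V). ?\<Psi> \<phi> = \<zero>\<^bsub>V\<^esub>}"
    then have \<phi>: "\<phi> \<in> carrier (dual_space K V)" "?\<Psi> \<phi> = \<zero>\<^bsub>V\<^esub>" by auto
    \<comment> \<open>Independence of \<open>B\<close> makes \<phi> vanish on \<open>B\<close>; its
      zero set is a subspace and so contains the span.\<close>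
    have z: "\<phi> \<in> B \<rightarrow> {\<zero>\<^bsub>K\<^esub>}"
      by (rule V.not_lindepD[OF B(3,1) order_refl dK[OF \<phi>(1)] \<phi>(2)])
    have "subspace K {x \<in> carrier V. \<phi> x = \<zero>\<^bsub>K\<^esub>} V"
      using subspace_kernel[OF D(5)[OF \<phi>(1)] subspace_carrier[OF V.vectorspace_axioms]] by simp
    then have "V.span B \<subseteq> {x \<in> carrier V. \<phi> x = \<zero>\<^bsub>K\<^esub>}"
      using z BV by (intro V.span_is_subset) auto
    then show "\<phi> \<in> annihilator K V U" using \<phi>(1) span by (auto simp: annihilator_def)
  next
    fix \<phi> assume "\<phi> \<in> annihilator K V U"
    then show "\<phi> \<in> {\<phi> \<in> carrier (dual_space K V). ?\<Psi> \<phi> = \<zero>\<^bsub>V\<^esub>}"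
      using V.lincomb_zero[OF BV] B(4) by (auto simp: annihilator_def)
  qed
  have im: "?\<Psi> ` carrier (dual_space K V) = U"
  proof (rule equalityI)
    show "?\<Psi> ` carrier (dual_space K V) \<subseteq> U"
      unfolding span[symmetric] V.finite_span[OF B(1) BV] using dK by blast
    have "b \<in> ?\<Psi> ` carrier (dual_space K V)" if b: "b \<in> B" for b
    proof -
      let ?\<phi> = "restrict (\<delta> b) (carrier V)"
      have "b \<in> C" using b C by blast
      note l = linear_mapD[OF \<delta>[OF this]]
      have \<phi>: "?\<phi> \<in> carrier (dual_space K V)"
        by (rule dual_spaceI[OF V.vectorspace_axioms]) (use l(3-5) in auto)
      have "?\<phi> c = (if c = b then \<one>\<^bsub>K\<^esub> else \<zero>\<^bsub>K\<^esub>)" if "c \<in> B" for c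
      proof -
        have c: "c \<in> C" "c \<in> carrier V" using that C CV by auto
        show ?thesis
          using coeff[of "\<lambda>w. if w = c then \<one>\<^bsub>K\<^esub> else \<zero>\<^bsub>K\<^esub>" b] \<open>b \<in> C\<close>
            V.lincomb_unit[OF C(2) CV c(1)] c by auto
      qed
      then have "?\<Psi> ?\<phi> = V.lincomb (\<lambda>c. if c = b then \<one>\<^bsub>K\<^esub> else \<zero>\<^bsub>K\<^esub>) B"
        using BV by (intro V.lincomb_cong) auto
      also have "\<dots> = b" by (rule V.lincomb_unit[OF B(1) BV b])
      finally show ?thesis using \<phi> by (metis imageI)
    qed
    then have "B \<subseteq> l.im" by (auto simp: l.im_def)
    then have "V.span B \<subseteq> l.im" using l.imT_is_subspace by (intro V.span_is_subset) auto
    then show "U \<subseteq> ?\<Psi> ` carrier (dual_space K V)" by (simp add: span l.im_def)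
  qed
  show ?thesis
    using rank_nullity_subspace[OF lin fin_dim_dual_space subspace_carrier[OF l.V.vectorspace_axioms]]
    unfolding ker im by simp
qed

text \<open>For the subspace \<open>carrier V\<close> the annihilator is zero, and
  \<open>dim_annihilator_aux\<close> compares the two spaces directly.\<close>

lemma dim_dual_space: "vectorspace.dim K (dual_space K V) = vectorspace.dim K V"
  using dim_annihilator_aux[OF subspace_carrier[OF V.vectorspace_axioms]]
    subdim_zero[OF vectorspace_dual_space[OF V.vectorspace_axioms]]
  by (simp add: annihilator_carrier[OF V.vectorspace_axioms])

lemma dim_annihilator:
  "subspace K U V \<Longrightarrow>
    subdim K (dual_space K V) (annihilator K V U) + subdim K V U = vectorspace.dim K V"
  using dim_annihilator_aux dim_dual_space by simp

end

section \<open>Adjoint maps and annihilators\<close>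

context
  fixes K :: "('k, 'r) ring_scheme" and M :: "('k, 'm) module" and V :: "('k, 'v) module" and f
  assumes f: "linear_map K M V f" and M: "fin_dim_space K M" and V: "fin_dim_space K V"
begin

interpretation M: fin_dim_space K M by (rule M)
interpretation V: fin_dim_space K V by (rule V)

lemma linear_map_adjoint: "linear_map K (dual_space K V) (dual_space K M) (adjoint M f)"
proof (intro linear_mapI vectorspace_dual_space M.vectorspace_axioms V.vectorspace_axioms)
  show "adjoint M f \<in> carrier (dual_space K V) \<rightarrow> carrier (dual_space K M)"
    by (intro funcsetI dual_spaceI M.vectorspace_axioms)
      (auto simp: adjoint_def linear_mapD(3-5)[OF f] dual_spaceD(1-3)[OF V.vectorspace_axioms])
qed (auto simp: adjoint_def dual_space_simps[OF M.vectorspace_axioms]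
    dual_space_simps[OF V.vectorspace_axioms] linear_mapD(3)[OF f])

lemma adjoint_preimage_annihilator:
  assumes "U \<subseteq> carrier M"
  shows "{\<phi> \<in> carrier (dual_space K V). adjoint M f \<phi> \<in> annihilator K M U} = annihilator K V (f ` U)"
  using linear_mapD(3)[OF linear_map_adjoint] assms by (auto simp: annihilator_def adjoint_def)

text \<open>One inclusion is immediate. The other is a dimension count: on the annihilator of
  \<open>W\<close> the kernel of the adjoint is at most the annihilator of \<open>W\<close> + im
  \<open>f\<close>, so the image has dimension at least dim (\<open>W\<close> + im \<open>f\<close>)
  - dim \<open>W\<close>. This equals the codimension of the preimage of \<open>W\<close>.\<close>

lemma adjoint_image_annihilator:
  assumes W: "subspace K W V"
  shows "adjoint M f ` annihilator K V W = annihilator K M {x \<in> carrier M. f x \<in> W}"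
proof (rule subdim_eq_imp_eq[OF fin_dim_dual_space[OF M]])
  let ?P = "{x \<in> carrier M. f x \<in> W}" and ?g = "adjoint M f"
  have WV: "W \<subseteq> carrier V" using W by (rule subspaceD)
  note P = subspace_preimage[OF f W] and A = subspace_annihilator[OF V.vectorspace_axioms WV]
  show "subspace K (?g ` annihilator K V W) (dual_space K M)"
    by (rule subspace_image[OF linear_map_adjoint A])
  show "subspace K (annihilator K M ?P) (dual_space K M)"
    by (rule subspace_annihilator[OF M.vectorspace_axioms]) auto
  show "?g ` annihilator K V W \<subseteq> annihilator K M ?P"
    using linear_mapD(3)[OF linear_map_adjoint] by (auto simp: annihilator_def adjoint_def)
  let ?q = "\<lambda>x. W +>\<^bsub>V\<^esub> x" and ?S = "V.subspace_sum W (f ` carrier M)"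
  have im: "subspace K (f ` carrier M) V"
    by (rule subspace_image[OF f subspace_carrier[OF M.vectorspace_axioms]])
  have S: "subspace K ?S V" by (rule V.sum_is_subspace[OF W im])
  have WS: "W \<subseteq> ?S" and fS: "f ` carrier M \<subseteq> ?S"
    using V.in_sum_vs[OF W im] V.in_sum_vs[OF im W] V.vsum_comm[OF W im] by auto
  \<comment> \<open>Modulo \<open>W\<close> the sum and im \<open>f\<close> have the same
    projection; computing its dimension from each side gives \<open>dS\<close>.\<close>
  have "?q ` ?S = (\<lambda>x. ?q (f x)) ` carrier M"
  proof (rule equalityI)
    show "?q ` ?S \<subseteq> (\<lambda>x. ?q (f x)) ` carrier M"
    proof (clarsimp simp: V.submodule_sum_def)
      fix w x assume w: "w \<in> W" and x: "x \<in> carrier M"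
      have "?q (w \<oplus>\<^bsub>V\<^esub> f x) = ?q (f x)"
        using coset_add[OF W, of w "f x"] coset_add[OF W, of "\<zero>\<^bsub>V\<^esub>" "f x"]
          coset_eq_self_iff[OF W, of w] coset_eq_self_iff[OF W, of "\<zero>\<^bsub>V\<^esub>"] w WV
          linear_mapD(3)[OF f x] subspaceD(3)[OF W] by auto
      then show "?q (w \<oplus>\<^bsub>V\<^esub> f x) \<in> (\<lambda>x. ?q (f x)) ` carrier M" using x by blast
    qed
    show "(\<lambda>x. ?q (f x)) ` carrier M \<subseteq> ?q ` ?S" using fS by blast
  qed
  moreover have "?S \<inter> W = W" using WS by blast
  moreover have "{x \<in> carrier M. ?q (f x) = W} = ?P"
    using coset_eq_self_iff[OF W] linear_mapD(3)[OF f] by blast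
  ultimately have dS: "subdim K V ?S + subdim K M ?P = M.dim + subdim K V W"
    using dim_coset_image[OF W V S] rank_nullity_subspace[OF linear_map_comp[OF f linear_map_coset[OF W]] M
        subspace_carrier[OF M.vectorspace_axioms]]
    by (simp add: zero_quot_space[OF W])
  \<comment> \<open>A form that vanishes on \<open>W\<close> and is killed by the adjoint also
    vanishes on im \<open>f\<close>, hence on the sum. This bounds the kernel from above.\<close>
  have "annihilator K V ?S \<supseteq> {\<phi> \<in> annihilator K V W. ?g \<phi> = \<zero>\<^bsub>dual_space K M\<^esub>}"
  proof
    fix \<phi> assume "\<phi> \<in> {\<phi> \<in> annihilator K V W. ?g \<phi> = \<zero>\<^bsub>dual_space K M\<^esub>}"
    then have \<phi>: "\<phi> \<in> carrier (dual_space K V)" "\<forall>w\<in>W. \<phi> w = \<zero>\<^bsub>K\<^esub>"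
      and g: "?g \<phi> = \<zero>\<^bsub>dual_space K M\<^esub>" by (auto simp: annihilator_def)
    have "\<phi> (f x) = \<zero>\<^bsub>K\<^esub>" if "x \<in> carrier M" for x
      using fun_cong[OF g, of x] that by (simp add: adjoint_def dual_space_simps[OF M.vectorspace_axioms])
    then show "\<phi> \<in> annihilator K V ?S"
      using \<phi> dual_spaceD(2)[OF V.vectorspace_axioms \<phi>(1)] WV linear_mapD(3)[OF f]
      by (auto simp: annihilator_def V.submodule_sum_def subset_iff)
  qed
  from subdim_mono[OF fin_dim_dual_space[OF V] subspace_kernel[OF linear_map_adjoint A] _ this]
  have "subdim K (dual_space K V) {\<phi> \<in> annihilator K V W. ?g \<phi> = \<zero>\<^bsub>dual_space K M\<^esub>}
      \<le> subdim K (dual_space K V) (annihilator K V ?S)"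
    using subspace_annihilator[OF V.vectorspace_axioms subspaceD(2)[OF S]] by blast
  then show "subdim K (dual_space K M) (annihilator K M ?P)
      \<le> subdim K (dual_space K M) (?g ` annihilator K V W)"
    using rank_nullity_subspace[OF linear_map_adjoint fin_dim_dual_space[OF V] A]
      dim_annihilator[OF V W] dim_annihilator[OF V S] dim_annihilator[OF M P] dS
    by linarith
qed

end

section \<open>Iterated reductions and duality\<close>

text \<open>All iterated reductions share \<open>E\<close> and \<open>A\<close>, so each of them is
  determined by two carriers.\<close>

definition restrict_system :: "('k, 'm, 'v) lin_system \<Rightarrow> 'm set \<Rightarrow> 'v set \<Rightarrow> ('k, 'm, 'v) lin_system" where
  "restrict_system S M' V' = S\<lparr>sys_dom := (sys_dom S)\<lparr>carrier := M'\<rparr>, sys_cod := (sys_cod S)\<lparr>carrier := V'\<rparr>\<rparr>"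

lemma restrict_system_simps [simp]:
  "sys_dom (restrict_system S M' V') = (sys_dom S)\<lparr>carrier := M'\<rparr>"
  "sys_cod (restrict_system S M' V') = (sys_cod S)\<lparr>carrier := V'\<rparr>"
  "sys_E (restrict_system S M' V') = sys_E S"
  "sys_A (restrict_system S M' V') = sys_A S"
  by (simp_all add: restrict_system_def)

lemma reduce_eq_restrict_system: "reduce S = restrict_system S (red_dom S) (red_cod S)"
  by (simp add: reduce_def restrict_system_def)

lemma restrict_restrict_system [simp]:
  "restrict_system (restrict_system S M' V') M'' V'' = restrict_system S M'' V''"
  by (simp add: restrict_system_def)

lemma restrict_system_self [simp]:
  "restrict_system S (carrier (sys_dom S)) (carrier (sys_cod S)) = S"
  by (simp add: restrict_system_def)

text \<open>The preimage is taken in the whole domain instead of the previous one, which keeps the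
  recursion inside the original system. As the chain decreases, the result is the iterated reduction
  (\<open>iterate_reduce\<close>).\<close>

primrec iter_cod :: "('k, 'm, 'v) lin_system \<Rightarrow> nat \<Rightarrow> 'v set" where
  "iter_cod S 0 = carrier (sys_cod S)"
| "iter_cod S (Suc k) = sys_E S ` {x \<in> carrier (sys_dom S). sys_A S x \<in> iter_cod S k}"

definition iter_dom :: "('k, 'm, 'v) lin_system \<Rightarrow> nat \<Rightarrow> 'm set" where
  "iter_dom S k = {x \<in> carrier (sys_dom S). sys_A S x \<in> iter_cod S k}"

text \<open>
  \<open>ker_chain S k\<close> consists of the \<open>x\<^sub>k\<close> of all chains with \<open>x\<^sub>0 = 0\<close> and \<open>E x\<^sub>i = A x\<^sub>i\<^sub>-\<^sub>1\<close>. It is dual to the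
  reduction: its annihilator is the codomain of the \<open>k\<close>-th reduction of the dual system.
\<close>

primrec ker_chain :: "('k, 'm, 'v) lin_system \<Rightarrow> nat \<Rightarrow> 'm set" where
  "ker_chain S 0 = {\<zero>\<^bsub>sys_dom S\<^esub>}"
| "ker_chain S (Suc k) = {x \<in> carrier (sys_dom S). sys_E S x \<in> sys_A S ` ker_chain S k}"

lemma iter_cod_Suc: "iter_cod S (Suc k) = sys_E S ` iter_dom S k"
  by (simp add: iter_dom_def)

declare iter_cod.simps(2) [simp del]

locale linear_system =
  fixes K :: "('k, 'r) ring_scheme" and S :: "('k, 'm, 'v) lin_system"
  assumes is_system: "is_system K S"
begin

abbreviation "M \<equiv> sys_dom S"
abbreviation "V \<equiv> sys_cod S"
abbreviation "E \<equiv> sys_E S"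
abbreviation "A \<equiv> sys_A S"

lemma linear_E: "linear_map K M V E" and linear_A: "linear_map K M V A"
  using is_system by (simp_all add: is_system_def)

lemma fin_dim_dom: "fin_dim_space K M" and fin_dim_cod: "fin_dim_space K V"
  using is_system linear_mapD(1,2)[OF linear_E]
  by (simp_all add: is_system_def fin_dim_space_def fin_dim_space_axioms_def)

sublocale M: fin_dim_space K M by (rule fin_dim_dom)
sublocale V: fin_dim_space K V by (rule fin_dim_cod)

lemma is_system_restrict:
  assumes M': "subspace K M' M" and V': "subspace K V' V" and "E ` M' \<subseteq> V'" "A ` M' \<subseteq> V'"
  shows "is_system K (restrict_system S M' V')"
  using linear_map_restrict[OF linear_E M' V' assms(3)] linear_map_restrict[OF linear_A M' V' assms(4)]
    fin_dim_space.fin_dim[OF fin_dim_subspace[OF fin_dim_dom M']]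
    fin_dim_space.fin_dim[OF fin_dim_subspace[OF fin_dim_cod V']] is_system
  by (simp add: is_system_def)

lemma subspace_iter_cod: "subspace K (iter_cod S k) V"
proof (induction k)
  case 0
  show ?case using subspace_carrier[OF V.vectorspace_axioms] by simp
next
  case (Suc k)
  then show ?case
    unfolding iter_cod.simps by (intro subspace_image[OF linear_E] subspace_preimage[OF linear_A])
qed

lemma subspace_iter_dom: "subspace K (iter_dom S k) M"
  unfolding iter_dom_def by (rule subspace_preimage[OF linear_A subspace_iter_cod])

lemma subspace_ker_chain: "subspace K (ker_chain S k) M"
proof (induction k)
  case 0
  show ?case using subspace_zero[OF M.vectorspace_axioms] by simp
next
  case (Suc k)
  then show ?case
    unfolding ker_chain.simps by (intro subspace_preimage[OF linear_E] subspace_image[OF linear_A])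
qed

lemma iter_cod_Suc_subset: "iter_cod S (Suc k) \<subseteq> iter_cod S k"
proof (induction k)
  case 0
  show ?case using linear_mapD(3)[OF linear_E] by (auto simp: iter_cod.simps)
next
  case (Suc k)
  \<comment> \<open>The operator that takes the preimage under \<open>A\<close> and then the image
    under \<open>E\<close> is monotone.\<close>
  then show ?case by (subst (1 2) iter_cod.simps(2)) blast
qed

lemma iter_dom_0: "iter_dom S 0 = carrier M"
  using linear_mapD(3)[OF linear_A] by (auto simp: iter_dom_def)

lemma red_cod_iterate: "red_cod (restrict_system S (iter_dom S k) (iter_cod S k)) = iter_cod S (Suc k)"
  by (simp add: red_cod_def iter_cod_Suc)

text \<open>Reduction looks for x in M_k with \<open>A x\<close> in V_(k+1). Since V_(k+1) lies in
  V_k, membership in M_k is automatic.\<close>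

lemma red_dom_iterate: "red_dom (restrict_system S (iter_dom S k) (iter_cod S k)) = iter_dom S (Suc k)"
  unfolding red_dom_def red_cod_iterate using iter_cod_Suc_subset by (auto simp: iter_dom_def)

lemma reduce_iterate:
  "reduce (restrict_system S (iter_dom S k) (iter_cod S k))
    = restrict_system S (iter_dom S (Suc k)) (iter_cod S (Suc k))"
  by (simp add: reduce_eq_restrict_system red_cod_iterate red_dom_iterate)

lemma iterate_reduce: "(reduce ^^ k) S = restrict_system S (iter_dom S k) (iter_cod S k)"
  by (induction k) (simp_all add: iter_dom_0 reduce_iterate)

lemma is_system_iterate: "is_system K (restrict_system S (iter_dom S k) (iter_cod S k))"
proof (rule is_system_restrict[OF subspace_iter_dom subspace_iter_cod])
  show "E ` iter_dom S k \<subseteq> iter_cod S k" using iter_cod_Suc_subset by (simp flip: iter_cod_Suc)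
qed (auto simp: iter_dom_def)

lemma red_cod_subspace: "subspace K (red_cod S) V"
  unfolding red_cod_def by (rule subspace_image[OF linear_E subspace_carrier[OF M.vectorspace_axioms]])

lemma red_dom_subspace: "subspace K (red_dom S) M"
  unfolding red_dom_def by (rule subspace_preimage[OF linear_A red_cod_subspace])

section \<open>Defects as differences of dimensions\<close>

lemma beta1_plus_eq:
  "beta1_plus K S + subdim K V (red_cod S) + M.dim = V.dim + subdim K M (red_dom S)"
  unfolding beta1_plus_def dom_quot_def cod_quot_def A_quot_def red_dom_def
  using red_dom_subspace unfolding red_dom_def
  by (intro dim_coker_quot_map linear_A red_cod_subspace fin_dim_dom fin_dim_cod) auto

text \<open>The kernel of [E] is P/M', where P is the preimage of V'' under \<open>E\<close>.
  Rank-nullity on P and on M, with the same kernel of \<open>E\<close>, gives dim P = dim V'' + dim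
  M - dim V'.\<close>

lemma alpha1_eq:
  "alpha1 K S + subdim K M (red_dom S) + subdim K V (red_cod S) = M.dim + subdim K V (red_cod (reduce S))"
proof -
  let ?V' = "V\<lparr>carrier := red_cod S\<rparr>" and ?V'' = "E ` red_dom S"
  let ?P = "{x \<in> carrier M. E x \<in> ?V''}"
  have M: "subspace K (carrier M) M" by (rule subspace_carrier[OF M.vectorspace_axioms])
  have cod: "red_cod (reduce S) = ?V''" by (simp add: red_cod_def reduce_eq_restrict_system)
  have sub: "red_dom S \<subseteq> carrier M" by (auto simp: red_dom_def)
  have V'': "subspace K ?V'' V" by (rule subspace_image[OF linear_E red_dom_subspace])
  have E': "linear_map K M ?V' E"
    using linear_map_restrict[OF linear_E M red_cod_subspace] by (simp add: red_cod_def)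
  have V''': "subspace K ?V'' ?V'"
    by (rule subspace_restrict[OF red_cod_subspace V'']) (use sub in \<open>auto simp: red_cod_def\<close>)
  have "alpha1 K S + subdim K M (red_dom S) = subdim K M ?P"
    using dim_ker_quot_map[OF E' red_dom_subspace V''' order_refl fin_dim_dom]
    unfolding alpha1_def dom_quot_def red_cod_quot_def E_quot_def cod
    by (simp add: reduce_eq_restrict_system)
  moreover have "E ` ?P = ?V''" using sub by auto
  moreover have "{x \<in> ?P. E x = \<zero>\<^bsub>V\<^esub>} = {x \<in> carrier M. E x = \<zero>\<^bsub>V\<^esub>}"
    using subspaceD(3)[OF V''] by auto
  ultimately show ?thesis
    unfolding cod
    using rank_nullity_subspace[OF linear_E fin_dim_dom subspace_preimage[OF linear_E V'']]
      rank_nullity_subspace[OF linear_E fin_dim_dom M] by (simp add: red_cod_def)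
qed

definition "ker_E_dim k = subdim K M {x \<in> iter_dom S k. E x = \<zero>\<^bsub>V\<^esub>}"
definition "ker_A_dim k = subdim K M {x \<in> ker_chain S k. A x = \<zero>\<^bsub>V\<^esub>}"

lemma dim_iter_cod_Suc: "subdim K V (iter_cod S (Suc k)) + ker_E_dim k = subdim K M (iter_dom S k)"
  unfolding iter_cod_Suc ker_E_dim_def
  by (rule rank_nullity_subspace[OF linear_E fin_dim_dom subspace_iter_dom])

lemma dim_A_ker_chain: "subdim K V (A ` ker_chain S k) + ker_A_dim k = subdim K M (ker_chain S k)"
  unfolding ker_A_dim_def
  by (rule rank_nullity_subspace[OF linear_A fin_dim_dom subspace_ker_chain])

lemma beta_plus_Suc_eq:
  "beta_plus K S (Suc k) + subdim K V (iter_cod S (Suc k)) + subdim K M (iter_dom S k)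
    = subdim K V (iter_cod S k) + subdim K M (iter_dom S (Suc k))"
proof -
  interpret T: linear_system K "restrict_system S (iter_dom S k) (iter_cod S k)"
    by unfold_locales (rule is_system_iterate)
  show ?thesis
    using T.beta1_plus_eq by (simp add: beta_plus_def iterate_reduce red_cod_iterate red_dom_iterate)
qed

text \<open>In \<open>alpha1_eq\<close> for the k-th reduction, dim M_k - dim V_(k+1) is e_k and dim
  M_(k+1) - dim V_(k+2) is e_(k+1).\<close>

lemma alpha_Suc_eq: "alpha K S (Suc k) + ker_E_dim (Suc k) = ker_E_dim k"
proof -
  interpret T: linear_system K "restrict_system S (iter_dom S k) (iter_cod S k)"
    by unfold_locales (rule is_system_iterate)
  have "alpha K S (Suc k) + subdim K M (iter_dom S (Suc k)) + subdim K V (iter_cod S (Suc k))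
    = subdim K M (iter_dom S k) + subdim K V (iter_cod S (Suc (Suc k)))"
    using T.alpha1_eq
    by (simp add: alpha_def iterate_reduce reduce_iterate red_cod_iterate red_dom_iterate)
  then show ?thesis using dim_iter_cod_Suc[of k] dim_iter_cod_Suc[of "Suc k"] by linarith
qed

text \<open>\<open>A\<close> on the left intersection and \<open>E\<close> on the right one have the
  same image \<open>?Z\<close>. Intersecting leaves both kernels intact, because 0 lies in V_(j+1)
  and in A P_i.\<close>

lemma dim_ker_chain_Int_iter_dom:
  "subdim K M (ker_chain S i \<inter> iter_dom S (Suc j)) + ker_E_dim j
    = subdim K M (ker_chain S (Suc i) \<inter> iter_dom S j) + ker_A_dim i"
proof -
  let ?X = "ker_chain S i \<inter> iter_dom S (Suc j)" and ?Y = "ker_chain S (Suc i) \<inter> iter_dom S j"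
  let ?Z = "A ` ker_chain S i \<inter> iter_cod S (Suc j)"
  note sub = subspaceD(2)[OF subspace_ker_chain]
  have AX: "A ` ?X = ?Z" using sub by (auto simp: iter_dom_def)
  have EY: "E ` ?Y = ?Z"
  proof (rule equalityI; rule subsetI)
    fix v assume "v \<in> ?Z"
    then have vA: "v \<in> A ` ker_chain S i" and "v \<in> E ` iter_dom S j" by (simp_all add: iter_cod_Suc)
    then obtain x where x: "x \<in> iter_dom S j" "v = E x" by blast
    then have "x \<in> ?Y" using vA by (simp add: iter_dom_def)
    then show "v \<in> E ` ?Y" using x(2) by blast
  qed (auto simp: iter_cod_Suc)
  have "{x \<in> ?X. A x = \<zero>\<^bsub>V\<^esub>} = {x \<in> ker_chain S i. A x = \<zero>\<^bsub>V\<^esub>}"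
    using subspaceD(3)[OF subspace_iter_cod, of "Suc j"] sub by (auto simp: iter_dom_def)
  then have X: "subdim K V ?Z + ker_A_dim i = subdim K M ?X"
    using rank_nullity_subspace[OF linear_A fin_dim_dom subspace_Int[OF subspace_ker_chain subspace_iter_dom],
        of i "Suc j"] by (simp add: AX ker_A_dim_def)
  have kerY: "{x \<in> ?Y. E x = \<zero>\<^bsub>V\<^esub>} = {x \<in> iter_dom S j. E x = \<zero>\<^bsub>V\<^esub>}"
    using subspaceD(3)[OF subspace_image[OF linear_A subspace_ker_chain], of i] by (auto simp: iter_dom_def)
  have "subdim K V (E ` ?Y) + subdim K M {x \<in> ?Y. E x = \<zero>\<^bsub>V\<^esub>} = subdim K M ?Y"
    by (rule rank_nullity_subspace[OF linear_E fin_dim_dom subspace_Int[OF subspace_ker_chain subspace_iter_dom]])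
  then have "subdim K V ?Z + ker_E_dim j = subdim K M ?Y"
    unfolding EY kerY ker_E_dim_def .
  with X show ?thesis by linarith
qed

text \<open>Telescopes the exchange of one step of the reduction for one step of the chain, with i +
  j constant. The induction raises i while it lowers j.\<close>

lemma dim_ker_chain_add:
  "subdim K M (ker_chain S (i + j)) + (\<Sum>l<j. ker_A_dim (i + l))
    = subdim K M (ker_chain S i \<inter> iter_dom S j) + (\<Sum>l<j. ker_E_dim l)"
proof (induction j arbitrary: i)
  case 0
  have "ker_chain S i \<inter> carrier M = ker_chain S i" using subspaceD(2)[OF subspace_ker_chain] by blast
  then show ?case by (simp add: iter_dom_0)
next
  case (Suc j)
  \<comment> \<open>The sum of the a's loses its first term, as i moves up, whereas the sum of the
    e's loses its last one.\<close>
  have "(\<Sum>l<Suc j. ker_A_dim (i + l)) = ker_A_dim i + (\<Sum>l<j. ker_A_dim (Suc i + l))"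
    by (simp add: sum.lessThan_Suc_shift del: sum.lessThan_Suc)
  moreover have "subdim K M (ker_chain S (i + Suc j)) = subdim K M (ker_chain S (Suc i + j))"
    by (simp only: add_Suc_right add_Suc)
  moreover have "(\<Sum>l<Suc j. ker_E_dim l) = (\<Sum>l<j. ker_E_dim l) + ker_E_dim j" by simp
  ultimately show ?case using Suc.IH[of "Suc i"] dim_ker_chain_Int_iter_dom[of i j] by linarith
qed

text \<open>With i = 0 the intersection is zero, so dim P_j is the sum of e_l - a_l over l < j; two
  consecutive values are compared.\<close>

lemma dim_ker_chain_Suc:
  "subdim K M (ker_chain S (Suc k)) + ker_A_dim k = subdim K M (ker_chain S k) + ker_E_dim k"
proof -
  have "subdim K M (ker_chain S j) + (\<Sum>l<j. ker_A_dim l) = (\<Sum>l<j. ker_E_dim l)" for j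
  proof -
    have "{\<zero>\<^bsub>M\<^esub>} \<inter> iter_dom S j = {\<zero>\<^bsub>M\<^esub>}" using subspaceD(3)[OF subspace_iter_dom] by blast
    then show ?thesis
      using dim_ker_chain_add[of 0 j] subdim_zero[OF M.vectorspace_axioms] by simp
  qed
  from this[of k] this[of "Suc k"] show ?thesis by (simp del: ker_chain.simps)
qed

section \<open>The dual system\<close>

abbreviation "S' \<equiv> dual_system K S"

lemma dual_system_simps:
  "sys_dom S' = dual_space K V" "sys_cod S' = dual_space K M"
  "sys_E S' = adjoint M E" "sys_A S' = adjoint M A"
  by (simp_all add: dual_system_def)

lemma is_system_dual: "is_system K S'"
  unfolding is_system_def dual_system_simps
  using linear_map_adjoint[OF linear_E fin_dim_dom fin_dim_cod] linear_map_adjoint[OF linear_A fin_dim_dom fin_dim_cod]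
    fin_dim_space.fin_dim[OF fin_dim_dual_space[OF fin_dim_dom]]
    fin_dim_space.fin_dim[OF fin_dim_dual_space[OF fin_dim_cod]] M.field_axioms by blast

interpretation dual: linear_system K S' by unfold_locales (rule is_system_dual)

text \<open>Under annihilators, preimage by the adjoint of \<open>A\<close> becomes image by
  \<open>A\<close>, and image by the adjoint of \<open>E\<close> becomes preimage by
  \<open>E\<close>. This is the recursion of \<open>ker_chain\<close>.\<close>

lemma iter_cod_dual: "iter_cod S' k = annihilator K M (ker_chain S k)"
proof (induction k)
  case 0
  show ?case by (simp add: dual_system_simps annihilator_zero[OF M.vectorspace_axioms])
next
  case (Suc k)
  note sub = subspaceD(2)[OF subspace_ker_chain]
  show ?case
    unfolding iter_cod.simps(2) Suc.IH dual_system_simps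
      adjoint_preimage_annihilator[OF linear_A fin_dim_dom fin_dim_cod sub]
      adjoint_image_annihilator[OF linear_E fin_dim_dom fin_dim_cod subspace_image[OF linear_A subspace_ker_chain]]
    by simp
qed

lemma iter_dom_dual: "iter_dom S' k = annihilator K V (A ` ker_chain S k)"
  unfolding iter_dom_def iter_cod_dual dual_system_simps
  by (rule adjoint_preimage_annihilator[OF linear_A fin_dim_dom fin_dim_cod subspaceD(2)[OF subspace_ker_chain]])

lemma dim_iter_cod_dual:
  "subdim K (sys_cod S') (iter_cod S' k) + subdim K M (ker_chain S k) = M.dim"
  unfolding iter_cod_dual dual_system_simps by (rule dim_annihilator[OF fin_dim_dom subspace_ker_chain])

lemma dim_iter_dom_dual:
  "subdim K (sys_dom S') (iter_dom S' k) + subdim K V (A ` ker_chain S k) = V.dim"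
  unfolding iter_dom_dual dual_system_simps
  by (rule dim_annihilator[OF fin_dim_cod subspace_image[OF linear_A subspace_ker_chain]])

text \<open>For the dual, e_k becomes (dim V - dim A P_k) - (dim M - dim P_(k+1)), which is e_k +
  dim V - dim M by \<open>dim_ker_chain_Suc\<close>. The shift is constant and drops out of the
  differences.\<close>

lemma alpha_dual: "alpha K S' (Suc k) = alpha K S (Suc k)"
  using alpha_Suc_eq[of k] dual.alpha_Suc_eq[of k] dual.dim_iter_cod_Suc[of k] dual.dim_iter_cod_Suc[of "Suc k"]
    dim_iter_cod_dual[of "Suc k"] dim_iter_cod_dual[of "Suc (Suc k)"]
    dim_iter_dom_dual[of k] dim_iter_dom_dual[of "Suc k"]
    dim_A_ker_chain[of k] dim_A_ker_chain[of "Suc k"] dim_ker_chain_Suc[of k] dim_ker_chain_Suc[of "Suc k"]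
  by linarith

lemma beta_plus_dual: "beta_plus K S' (Suc k) + ker_A_dim k = ker_A_dim (Suc k)"
  using dual.beta_plus_Suc_eq[of k] dim_iter_cod_dual[of k] dim_iter_cod_dual[of "Suc k"]
    dim_iter_dom_dual[of k] dim_iter_dom_dual[of "Suc k"]
    dim_A_ker_chain[of k] dim_A_ker_chain[of "Suc k"]
  by linarith

text \<open>Computing the chain of the dual directly from \<open>S\<close> spares the identification
  of a space with its bidual.\<close>

lemma ker_chain_dual: "ker_chain S' k = annihilator K V (iter_cod S k)"
proof (induction k)
  case 0
  show ?case by (simp add: dual_system_simps annihilator_carrier[OF V.vectorspace_axioms])
next
  case (Suc k)
  show ?case
    unfolding ker_chain.simps(2) Suc.IH dual_system_simps
      adjoint_image_annihilator[OF linear_A fin_dim_dom fin_dim_cod subspace_iter_cod]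
    using adjoint_preimage_annihilator[OF linear_E fin_dim_dom fin_dim_cod subspaceD(2)[OF subspace_iter_dom], of k]
    by (simp add: iter_cod_Suc iter_dom_def)
qed

text \<open>Rank-nullity for the adjoint of \<open>A\<close> on the annihilator of V_k, whose image
  is the annihilator of M_k.\<close>

lemma ker_A_dim_dual:
  "dual.ker_A_dim k + M.dim + subdim K V (iter_cod S k) = V.dim + subdim K M (iter_dom S k)"
proof -
  have "subdim K (sys_dom S') (ker_chain S' k) + subdim K V (iter_cod S k) = V.dim"
    unfolding ker_chain_dual dual_system_simps by (rule dim_annihilator[OF fin_dim_cod subspace_iter_cod])
  moreover have "sys_A S' ` ker_chain S' k = annihilator K M (iter_dom S k)"
    unfolding ker_chain_dual dual_system_simps iter_dom_def
    by (rule adjoint_image_annihilator[OF linear_A fin_dim_dom fin_dim_cod subspace_iter_cod])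
  then have "subdim K (sys_cod S') (sys_A S' ` ker_chain S' k) + subdim K M (iter_dom S k) = M.dim"
    using dim_annihilator[OF fin_dim_dom subspace_iter_dom] by (simp add: dual_system_simps)
  ultimately show ?thesis using dual.dim_A_ker_chain[of k] by linarith
qed

section \<open>The final reduction\<close>

lemma iter_cod_stationary: "\<exists>k. iter_cod S (Suc k) = iter_cod S k"
proof (rule ccontr)
  assume never: "\<not> ?thesis"
  have less: "subdim K V (iter_cod S (Suc k)) < subdim K V (iter_cod S k)" for k
  proof (rule ccontr)
    assume "\<not> subdim K V (iter_cod S (Suc k)) < subdim K V (iter_cod S k)"
    then have "subdim K V (iter_cod S k) \<le> subdim K V (iter_cod S (Suc k))" by simp
    from subdim_eq_imp_eq[OF fin_dim_cod subspace_iter_cod subspace_iter_cod iter_cod_Suc_subset this]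
    have "iter_cod S (Suc k) = iter_cod S k" .
    with never show False by blast
  qed
  have "subdim K V (iter_cod S k) + k \<le> V.dim" for k
  proof (induction k)
    case (Suc k)
    then show ?case using less[of k] by linarith
  qed simp
  from this[of "Suc V.dim"] show False by simp
qed

lemma reduce_inf_stationary:
  obtains k where "reduce_inf S = restrict_system S (iter_dom S k) (iter_cod S k)"
    "iter_cod S (Suc k) = iter_cod S k"
proof -
  obtain n where "iter_cod S (Suc n) = iter_cod S n" using iter_cod_stationary by blast
  \<comment> \<open>M_k is determined by V_k, so a repeated codomain repeats the whole system. This
    is the witness that gives the \<open>LEAST\<close> in \<open>sys_index\<close> its
    meaning.\<close>
  then have "(reduce ^^ Suc n) S = (reduce ^^ n) S"
    unfolding iterate_reduce by (simp add: iter_dom_def)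
  then have "(reduce ^^ Suc (sys_index S)) S = (reduce ^^ sys_index S) S"
    unfolding sys_index_def by (rule LeastI)
  then have "sys_cod ((reduce ^^ Suc (sys_index S)) S) = sys_cod ((reduce ^^ sys_index S) S)" by simp
  then have "iter_cod S (Suc (sys_index S)) = iter_cod S (sys_index S)"
    unfolding iterate_reduce restrict_system_simps by (metis partial_object.select_convs(1) partial_object.update_convs(1) module.surjective)
  then show thesis using that by (simp add: reduce_inf_def iterate_reduce)
qed

text \<open>\<open>beta_plus_dual\<close> for the final reduction expresses the left-hand defect by
  the a's of that reduction; they agree with the a's of \<open>S\<close>.\<close>

lemma beta_minus_eq: "beta_minus K S (Suc k) + ker_A_dim k = ker_A_dim (Suc k)"
proof -
  obtain n where n: "reduce_inf S = restrict_system S (iter_dom S n) (iter_cod S n)"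
    "iter_cod S (Suc n) = iter_cod S n" by (rule reduce_inf_stationary)
  let ?T = "restrict_system S (iter_dom S n) (iter_cod S n)"
  interpret T: linear_system K ?T by unfold_locales (rule is_system_iterate)
  have chain: "ker_chain ?T k = ker_chain S k \<inter> iter_dom S n" for k
  proof (induction k)
    case 0
    show ?case using subspaceD(3)[OF subspace_iter_dom] by auto
  next
    case (Suc k)
    \<comment> \<open>Stationarity enters here: E x lies in V_(n+1) = V_n, so the predecessor y of x
      in the chain lies in M_n again.\<close>
    have dom: "y \<in> iter_dom S n" if "x \<in> iter_dom S n" "E x = A y" "y \<in> ker_chain S k" for x y
    proof -
      have "A y \<in> iter_cod S n" using that(1) unfolding that(2)[symmetric] n(2)[symmetric] iter_cod_Suc by blast
      then show ?thesis using that(3) subspaceD(2)[OF subspace_ker_chain] by (auto simp: iter_dom_def)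
    qed
    have "{x \<in> iter_dom S n. E x \<in> A ` (ker_chain S k \<inter> iter_dom S n)} = ker_chain S (Suc k) \<inter> iter_dom S n"
    proof (rule equalityI; rule subsetI)
      fix x assume "x \<in> ker_chain S (Suc k) \<inter> iter_dom S n"
      then obtain y where x: "x \<in> iter_dom S n" and y: "y \<in> ker_chain S k" "E x = A y" by auto
      have "y \<in> iter_dom S n" by (rule dom[OF x y(2,1)])
      then have "E x \<in> A ` (ker_chain S k \<inter> iter_dom S n)" using y by simp
      then show "x \<in> {x \<in> iter_dom S n. E x \<in> A ` (ker_chain S k \<inter> iter_dom S n)}" using x by simp
    qed (auto simp: iter_dom_def)
    then show ?case by (simp add: Suc.IH)
  qed
  \<comment> \<open>If A x = 0 then x lies in M_n, so intersecting with M_n removes nothing.\<close>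
  have "{x \<in> ker_chain ?T k. A x = \<zero>\<^bsub>V\<^esub>} = {x \<in> ker_chain S k. A x = \<zero>\<^bsub>V\<^esub>}" for k
    using subspaceD(3)[OF subspace_iter_cod] subspaceD(2)[OF subspace_ker_chain]
    unfolding chain by (auto simp: iter_dom_def)
  then have "T.ker_A_dim k = ker_A_dim k" for k
    by (simp add: ker_A_dim_def T.ker_A_dim_def)
  then show ?thesis using T.beta_plus_dual[of k] by (simp add: beta_minus_def n(1))
qed

text \<open>\<open>beta_minus_eq\<close> for the dual gives a difference of its a's, and
  \<open>ker_A_dim_dual\<close> turns this into the formula for \<open>beta_plus\<close> of
  \<open>S\<close>.\<close>

lemma beta_minus_dual: "beta_minus K S' (Suc k) = beta_plus K S (Suc k)"
  using linear_system.beta_minus_eq[OF linear_system.intro[OF is_system_dual], of k] ker_A_dim_dual[of k] ker_A_dim_dual[of "Suc k"] beta_plus_Suc_eq[of k]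
  by linarith

end

theorem theorem8p7:
  fixes K :: "('k, 'r) ring_scheme"
    and S :: "('k, 'm, 'v) lin_system"
  assumes "is_system K S"
  shows "\<forall>k\<ge>1. alpha K (dual_system K S) k = alpha K S k
             \<and> beta_plus K (dual_system K S) k = beta_minus K S k
             \<and> beta_minus K (dual_system K S) k = beta_plus K S k"
proof (intro allI impI)
  fix k :: nat assume "k \<ge> 1"
  then obtain j where k: "k = Suc j" by (cases k) auto
  interpret linear_system K S by unfold_locales (rule assms)
  show "alpha K (dual_system K S) k = alpha K S k
      \<and> beta_plus K (dual_system K S) k = beta_minus K S k
      \<and> beta_minus K (dual_system K S) k = beta_plus K S k"
    \<comment> \<open>In the second equation both sides equal a_(j+1) - a_j.\<close>
    unfolding k using alpha_dual beta_minus_dual beta_plus_dual[of j] beta_minus_eq[of j] by simp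
qed

end
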